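(* Suppose $\Gamma$ is a finitely generated group satisfying one of the following conditions (i) through (v): (i) $\Gamma$ is very large; (ii) $\Gamma$ maps onto the wreath product of two infinite cyclic groups; (iii) $\Gamma$ maps onto the wreath product $\mathbb{Z}_m \wr C_\infty$ of a finite cyclic group of order $m > 1$ and an infinite cyclic group; (iv) $\Gamma$ maps onto a semi-direct product $A \rtimes C_\infty$ of an infinite, locally finite, abelian group $A$ by an infinite cyclic group; (v) $\Gamma$ maps onto an infinitely related metabelian group. Then the metabelian top $\Gamma/\Gamma''$ of $\Gamma$ does not admit a finite presentation.
   Context: $\Gamma'$ is the derived group of $\Gamma$ and $\Gamma''=(\Gamma')'$. The metabelian top of $\Gamma$ is $\Gamma/\Gamma''$. A group is metabelian if its second derived group is trivial. A finitely generated group is infinitely related if it does not admit a finite presentation. A finitely generated group is called very large if it maps onto a non-abelian free group. $\mathbb{Z}_m$ is the cyclic group of order $m$, $C_\infty$ is an infinite cyclic group, and $A \wr C_\infty$ is the restricted wreath product $\left(\bigoplus_{C_\infty} A\right) \rtimes C_\infty$. "Maps onto" means that there is an epimorphism onto the group in question. *)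

theory Defs
  imports "HOL-Algebra.Product_Groups" "HOL-Algebra.Bij"
begin

section \<open>Free groups and finite presentations\<close>

text \<open>
  A letter is a pair \<open>(x, b)\<close>; \<open>b = True\<close> stands for the generator \<open>x\<close> and \<open>b = False\<close> for its
  formal inverse. The free group on \<open>S\<close> consists of the words over \<open>S\<close> modulo insertion and
  deletion of adjacent mutually inverse letters.
\<close>

type_synonym 'x letter = "'x \<times> bool"

definition group_words :: "'x set \<Rightarrow> 'x letter list set" where
  "group_words S = lists (S \<times> UNIV)"

inductive_set free_rel :: "'x set \<Rightarrow> ('x letter list \<times> 'x letter list) set" for S :: "'x set" where
  cancel: "\<lbrakk>u \<in> group_words S; v \<in> group_words S; x \<in> S\<rbrakk>
    \<Longrightarrow> (u @ [(x, b), (x, \<not> b)] @ v, u @ v) \<in> free_rel S"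
| refl: "w \<in> group_words S \<Longrightarrow> (w, w) \<in> free_rel S"
| sym: "(u, v) \<in> free_rel S \<Longrightarrow> (v, u) \<in> free_rel S"
| trans: "\<lbrakk>(u, v) \<in> free_rel S; (v, w) \<in> free_rel S\<rbrakk> \<Longrightarrow> (u, w) \<in> free_rel S"

definition free_group :: "'x set \<Rightarrow> 'x letter list set monoid" where
  "free_group S =
    \<lparr>carrier = group_words S // free_rel S,
     monoid.mult = (\<lambda>A B. \<Union>a\<in>A. \<Union>b\<in>B. free_rel S `` {a @ b}),
     one = free_rel S `` {[]}\<rparr>"

text \<open>
  It is no restriction to take the basis from the type of the group itself: a basis of a free
  group is a subset of its carrier.
\<close>

definition is_free_group :: "('a, 'b) monoid_scheme \<Rightarrow> bool" where
  "is_free_group F \<longleftrightarrow> group F \<and> (\<exists>S::'a set. F \<cong> free_group S)"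

definition normal_closure :: "('a, 'b) monoid_scheme \<Rightarrow> 'a set \<Rightarrow> 'a set" where
  "normal_closure G R = \<Inter>{N. N \<lhd> G \<and> R \<subseteq> N}"

definition finitely_generated :: "('a, 'b) monoid_scheme \<Rightarrow> bool" where
  "finitely_generated G \<longleftrightarrow> (\<exists>S \<subseteq> carrier G. finite S \<and> generate G S = carrier G)"

definition finitely_presented :: "('a, 'b) monoid_scheme \<Rightarrow> bool" where
  "finitely_presented G \<longleftrightarrow>
    (\<exists>(n::nat) R. finite R \<and> R \<subseteq> carrier (free_group {..<n}) \<and>
       G \<cong> free_group {..<n} Mod normal_closure (free_group {..<n}) R)"

definition infinitely_related :: "('a, 'b) monoid_scheme \<Rightarrow> bool" where
  "infinitely_related G \<longleftrightarrow> finitely_generated G \<and> \<not> finitely_presented G"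

definition maps_onto :: "('a, 'b) monoid_scheme \<Rightarrow> ('c, 'd) monoid_scheme \<Rightarrow> bool" where
  "maps_onto G H \<longleftrightarrow> epi G H \<noteq> {}"

text \<open>
  HOL has no quantification over types inside a definition, so the type \<open>'f\<close> from which the free
  image is taken is a parameter. When this predicate is a hypothesis and \<open>'f\<close> is a type variable
  occurring nowhere else, the free image is arbitrary.
\<close>

definition very_large :: "'f itself \<Rightarrow> ('a, 'b) monoid_scheme \<Rightarrow> bool" where
  "very_large (_ :: 'f itself) G \<longleftrightarrow>
    finitely_generated G \<and>
    (\<exists>F::'f monoid. is_free_group F \<and> \<not> comm_group F \<and> maps_onto G F)"


section \<open>Derived series and local finiteness\<close>

definition second_derived :: "('a, 'b) monoid_scheme \<Rightarrow> 'a set" where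
  "second_derived G = derived G (derived G (carrier G))"

definition metabelian :: "('a, 'b) monoid_scheme \<Rightarrow> bool" where
  "metabelian G \<longleftrightarrow> second_derived G = {\<one>\<^bsub>G\<^esub>}"

definition metabelian_top :: "('a, 'b) monoid_scheme \<Rightarrow> 'a set monoid" where
  "metabelian_top G = G Mod second_derived G"

definition locally_finite :: "('a, 'b) monoid_scheme \<Rightarrow> bool" where
  "locally_finite G \<longleftrightarrow> (\<forall>S \<subseteq> carrier G. finite S \<longrightarrow> finite (generate G S))"


section \<open>Semidirect and wreath products\<close>

text \<open>The action \<open>\<phi>\<close> is meant to be an element of \<open>hom Q (AutoGroup N)\<close>.\<close>

definition semidirect_product ::
    "('n, 'c) monoid_scheme \<Rightarrow> ('q, 'd) monoid_scheme \<Rightarrow> ('q \<Rightarrow> 'n \<Rightarrow> 'n) \<Rightarrow> ('n \<times> 'q) monoid" where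
  "semidirect_product N Q \<phi> =
    \<lparr>carrier = carrier N \<times> carrier Q,
     monoid.mult = (\<lambda>(a, q) (b, r). (a \<otimes>\<^bsub>N\<^esub> \<phi> q b, q \<otimes>\<^bsub>Q\<^esub> r)),
     one = (\<one>\<^bsub>N\<^esub>, \<one>\<^bsub>Q\<^esub>)\<rparr>"

text \<open>\<^const>\<open>sum_group\<close> is the direct sum, i.e. the finitely supported families.\<close>

definition wreath_base ::
    "('a, 'c) monoid_scheme \<Rightarrow> ('q, 'd) monoid_scheme \<Rightarrow> ('q \<Rightarrow> 'a) monoid" where
  "wreath_base A Q = sum_group (carrier Q) (\<lambda>_. A)"

definition wreath_action ::
    "('a, 'c) monoid_scheme \<Rightarrow> ('q, 'd) monoid_scheme \<Rightarrow> 'q \<Rightarrow> ('q \<Rightarrow> 'a) \<Rightarrow> 'q \<Rightarrow> 'a" where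
  "wreath_action A Q q =
    (\<lambda>f \<in> carrier (wreath_base A Q). \<lambda>x \<in> carrier Q. f (inv\<^bsub>Q\<^esub> q \<otimes>\<^bsub>Q\<^esub> x))"

definition wreath_product ::
    "('a, 'c) monoid_scheme \<Rightarrow> ('q, 'd) monoid_scheme \<Rightarrow> (('q \<Rightarrow> 'a) \<times> 'q) monoid" where
  "wreath_product A Q = semidirect_product (wreath_base A Q) Q (wreath_action A Q)"

end

theory Submission
  imports Defs Complex_Main
begin

text \<open>
  Finitely generated metabelian groups satisfy the maximal condition on normal subgroups (P. Hall),
  by the argument of Hilbert's basis theorem applied to the derived group as a module over the
  abelianisation. Hence every metabelian quotient of a group with finitely presented metabelian top
  is again finitely presented, and it suffices to exhibit metabelian quotients that are not.

  Cases (i) to (iii) yield a homomorphism to \<open>\<int>\<^sub>m \<wr> C\<^sub>\<infinity>\<close> whose image contains \<open>t\<close> and infinitely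
  many elements of the base, so as in (iv) there is a quotient \<open>Q\<close> that is an extension of an
  infinite, locally finite, abelian group \<open>N\<close> by \<open>\<langle>t\<rangle> \<cong> C\<^sub>\<infinity>\<close>. Such a \<open>Q\<close> is not finitely presented:
  finitely many relations only see a finite subgroup \<open>C\<close> of \<open>N\<close> and the partial isomorphism that
  \<open>t\<close> induces on it. They remain valid if \<open>C\<close> acts on the set \<open>N\<close> by translations and \<open>t\<close> is replaced
  by a permutation \<open>\<tau>\<close> inducing the same partial isomorphism. As \<open>C\<close> is not normalised by \<open>t\<close>, the
  permutation \<open>\<tau>\<close> can be chosen such that \<open>\<tau> C \<tau>\<^sup>-\<^sup>1\<close> and \<open>C\<close> do not commute, although their
  counterparts in \<open>N\<close> do. This replaces the usual argument with HNN extensions.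
\<close>

section \<open>Free groups and finite presentations\<close>

text \<open>The obstacle is that \<open>\<tau>\<close> imitates \<open>t\<close> only on part of a
  finite subgroup, so that nothing is known about arbitrary words in it. Words are therefore
  evaluated on both sides in the normal form a t^k. The two evaluations agree as long as every
  conjugate that arises stays within a bounded range of powers of \<open>t\<close>. This range
  depends on the word but not on \<open>\<tau>\<close>, and the order of the choices is essential:
  one range serves all relators, and \<open>\<tau>\<close> is built afterwards. Finiteness of
  \<open>C\<close> enters twice. A finite subgroup invariant under conjugation by \<open>t\<close>
  in one direction is invariant in both, and would then be all of the infinite group
  \<open>N\<close>; so elements leave \<open>C\<close> in either direction. Moreover finitely many
  cosets of a finite subgroup do not exhaust \<open>N\<close>, which leaves room for a modification
  of \<open>t\<close> away from the points where it must be kept. In the maximal condition the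
  operators are conjugations, hence invertible. The ring behind the argument is one of Laurent
  polynomials, and negative exponents are cleared by applying a power of the operator.\<close>

lemma group_words_Nil [simp]: "[] \<in> group_words S"
  by (simp add: group_words_def)

lemma group_words_append [simp]:
  "u @ v \<in> group_words S \<longleftrightarrow> u \<in> group_words S \<and> v \<in> group_words S"
  by (auto simp: group_words_def)

lemma group_words_Cons [simp]:
  "a # w \<in> group_words S \<longleftrightarrow> fst a \<in> S \<and> w \<in> group_words S"
  by (cases a) (auto simp: group_words_def)

lemma free_rel_words: "(u, v) \<in> free_rel S \<Longrightarrow> u \<in> group_words S \<and> v \<in> group_words S"
  by (induction rule: free_rel.induct) auto

lemma equiv_free_rel: "equiv (group_words S) (free_rel S)"
  by (rule equivI)
     (auto simp: refl_on_def sym_def trans_def dest: free_rel_words free_rel.sym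
           intro: free_rel.refl free_rel.trans)

lemma free_rel_append_left:
  "(u, v) \<in> free_rel S \<Longrightarrow> w \<in> group_words S \<Longrightarrow> (w @ u, w @ v) \<in> free_rel S"
proof (induction rule: free_rel.induct)
  case (cancel u v x b)
  then show ?case
    using free_rel.cancel[of "w @ u" S v x b] by simp
qed (auto intro: free_rel.refl free_rel.sym free_rel.trans)

lemma free_rel_append_right:
  "(u, v) \<in> free_rel S \<Longrightarrow> w \<in> group_words S \<Longrightarrow> (u @ w, v @ w) \<in> free_rel S"
proof (induction rule: free_rel.induct)
  case (cancel u v x b)
  then show ?case
    using free_rel.cancel[of u S "v @ w" x b] by simp
qed (auto intro: free_rel.refl free_rel.sym free_rel.trans)

lemma free_rel_append:
  "(u, u') \<in> free_rel S \<Longrightarrow> (v, v') \<in> free_rel S \<Longrightarrow> (u @ v, u' @ v') \<in> free_rel S"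
  using free_rel.trans[OF free_rel_append_right[of u u' S v] free_rel_append_left[of v v' S u']]
  by (auto dest: free_rel_words)

definition word_class :: "'x set \<Rightarrow> 'x letter list \<Rightarrow> 'x letter list set" where
  "word_class S w = free_rel S `` {w}"

lemma word_class_eq_iff:
  "u \<in> group_words S \<Longrightarrow> v \<in> group_words S \<Longrightarrow>
    word_class S u = word_class S v \<longleftrightarrow> (u, v) \<in> free_rel S"
  unfolding word_class_def using eq_equiv_class_iff[OF equiv_free_rel] by blast

lemma carrier_free_group: "carrier (free_group S) = word_class S ` group_words S"
  by (auto simp: free_group_def quotient_def word_class_def)

lemma one_free_group: "\<one>\<^bsub>free_group S\<^esub> = word_class S []"
  by (simp add: free_group_def word_class_def)

text \<open>The product of two classes is a union over all pairs of representatives; since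
  \<open>free_rel\<close> is a congruence, all members of this union are one and the same
  class.\<close>

lemma mult_free_group:
  assumes "u \<in> group_words S" "v \<in> group_words S"
  shows "word_class S u \<otimes>\<^bsub>free_group S\<^esub> word_class S v = word_class S (u @ v)"
proof -
  have "word_class S (a @ b) = word_class S (u @ v)"
    if "a \<in> word_class S u" "b \<in> word_class S v" for a b
  proof -
    have "(u, a) \<in> free_rel S" "(v, b) \<in> free_rel S"
      using that by (auto simp: word_class_def)
    then have "(u @ v, a @ b) \<in> free_rel S"
      by (rule free_rel_append)
    then show ?thesis
      using free_rel_words[of "u @ v" "a @ b"] word_class_eq_iff[of "a @ b" S "u @ v"] free_rel.sym
      by blast
  qed
  moreover have "u \<in> word_class S u" "v \<in> word_class S v"
    using assms by (auto simp: word_class_def free_rel.refl)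
  moreover have "word_class S u \<otimes>\<^bsub>free_group S\<^esub> word_class S v =
      (\<Union>a\<in>word_class S u. \<Union>b\<in>word_class S v. word_class S (a @ b))"
    by (simp add: free_group_def word_class_def)
  ultimately show ?thesis
    by blast
qed

definition inverse_word :: "'x letter list \<Rightarrow> 'x letter list" where
  "inverse_word w = rev (map (\<lambda>(x, b). (x, \<not> b)) w)"

lemma inverse_word_mem [simp]: "w \<in> group_words S \<Longrightarrow> inverse_word w \<in> group_words S"
  by (auto simp: inverse_word_def group_words_def)

lemma inverse_word_cancel:
  "w \<in> group_words S \<Longrightarrow> (inverse_word w @ w, []) \<in> free_rel S"
proof (induction w)
  case (Cons a w)
  obtain x b where a: "a = (x, b)" by (cases a)
  \<comment> \<open>The double negation puts the middle pair into the shape of the rule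
    \<open>cancel\<close>, with \<open>\<not> b\<close> as its first sign.\<close>
  have *: "inverse_word (a # w) @ a # w = inverse_word w @ [(x, \<not> b), (x, \<not> \<not> b)] @ w"
    by (simp add: inverse_word_def a)
  have "(inverse_word (a # w) @ a # w, inverse_word w @ w) \<in> free_rel S"
    unfolding * using Cons.prems a by (intro free_rel.cancel) auto
  then show ?case
    using Cons by (auto intro: free_rel.trans)
qed (simp add: inverse_word_def free_rel.refl)

lemma group_free_group [simp]: "group (free_group S)"
proof (rule groupI)
  fix A assume "A \<in> carrier (free_group S)"
  then obtain w where w: "w \<in> group_words S" "A = word_class S w"
    by (auto simp: carrier_free_group)
  then have "word_class S (inverse_word w) \<otimes>\<^bsub>free_group S\<^esub> A = \<one>\<^bsub>free_group S\<^esub>"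
    by (simp add: mult_free_group one_free_group word_class_eq_iff inverse_word_cancel)
  then show "\<exists>B\<in>carrier (free_group S). B \<otimes>\<^bsub>free_group S\<^esub> A = \<one>\<^bsub>free_group S\<^esub>"
    using w by (auto simp: carrier_free_group)
qed (auto simp: carrier_free_group one_free_group mult_free_group)

definition free_gen :: "'x set \<Rightarrow> 'x \<Rightarrow> 'x letter list set" where
  "free_gen S x = word_class S [(x, True)]"

lemma free_gen_closed [simp]: "x \<in> S \<Longrightarrow> free_gen S x \<in> carrier (free_group S)"
  by (simp add: carrier_free_group free_gen_def)

lemma inv_free_gen:
  "x \<in> S \<Longrightarrow> inv\<^bsub>free_group S\<^esub> (free_gen S x) = word_class S [(x, False)]"
  by (rule group.inv_equality)
     (use free_rel.cancel[of "[]" S "[]" x False]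
      in \<open>auto simp: free_gen_def mult_free_group carrier_free_group one_free_group word_class_eq_iff\<close>)

lemma generate_free_group: "generate (free_group S) (free_gen S ` S) = carrier (free_group S)"
proof
  interpret group "free_group S" by simp
  show "generate (free_group S) (free_gen S ` S) \<subseteq> carrier (free_group S)"
    by (rule generate_incl) auto
  have "word_class S w \<in> generate (free_group S) (free_gen S ` S)" if "w \<in> group_words S" for w
    using that
  proof (induction w)
    case Nil
    then show ?case using generate.one[of "free_group S"] by (simp add: one_free_group)
  next
    case (Cons a w)
    obtain x b where a: "a = (x, b)" by (cases a)
    have "word_class S [a] = (if b then free_gen S x else inv\<^bsub>free_group S\<^esub> (free_gen S x))"
      using Cons.prems inv_free_gen[of x S] by (simp add: a) (simp add: free_gen_def)
    then have "word_class S [a] \<in> generate (free_group S) (free_gen S ` S)"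
      using Cons.prems by (auto simp: a intro: generate.incl generate.inv)
    then show ?case
      using Cons generate.eng[of "word_class S [a]" "free_group S" _ "word_class S w"]
      by (simp add: mult_free_group)
  qed
  then show "carrier (free_group S) \<subseteq> generate (free_group S) (free_gen S ` S)"
    by (auto simp: carrier_free_group)
qed

section \<open>Evaluation of words and the universal property of free groups\<close>

fun word_eval :: "('b, 'm) monoid_scheme \<Rightarrow> ('x \<Rightarrow> 'b) \<Rightarrow> 'x letter list \<Rightarrow> 'b" where
  "word_eval H f [] = \<one>\<^bsub>H\<^esub>"
| "word_eval H f ((x, b) # w) = (if b then f x else inv\<^bsub>H\<^esub> (f x)) \<otimes>\<^bsub>H\<^esub> word_eval H f w"

context group
begin

lemma word_eval_closed [simp]:
  "f \<in> S \<rightarrow> carrier G \<Longrightarrow> w \<in> group_words S \<Longrightarrow> word_eval G f w \<in> carrier G"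
proof (induction w)
  case (Cons a w)
  then show ?case by (cases a) (auto simp: Pi_iff)
qed simp

lemma word_eval_append:
  "f \<in> S \<rightarrow> carrier G \<Longrightarrow> u \<in> group_words S \<Longrightarrow> v \<in> group_words S \<Longrightarrow>
    word_eval G f (u @ v) = word_eval G f u \<otimes> word_eval G f v"
proof (induction u)
  case (Cons a u)
  then show ?case
    by (cases a) (auto simp: m_assoc Pi_iff)
qed simp

lemma word_eval_free_rel:
  assumes f: "f \<in> S \<rightarrow> carrier G"
  shows "(u, v) \<in> free_rel S \<Longrightarrow> word_eval G f u = word_eval G f v"
proof (induction rule: free_rel.induct)
  case (cancel u v x b)
  have "f x \<in> carrier G" using f cancel by auto
  then have "word_eval G f ([(x, b), (x, \<not> b)] @ v) = word_eval G f v"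
    using cancel f by (cases b) (simp_all flip: m_assoc)
  moreover have "[(x, b), (x, \<not> b)] @ v \<in> group_words S" using cancel by simp
  ultimately show ?case
    using cancel word_eval_append[OF f] by metis
qed auto

lemma free_group_lift:
  assumes f: "f \<in> S \<rightarrow> carrier G"
  obtains h where "h \<in> hom (free_group S) G" "\<And>x. x \<in> S \<Longrightarrow> h (free_gen S x) = f x"
proof
  \<comment> \<open>Evaluation is constant on classes by \<open>word_eval_free_rel\<close>, so the
    image of a class is a singleton and \<open>the_elem\<close> is well defined on it.\<close>
  define h where "h C = the_elem (word_eval G f ` C)" for C
  have h: "h (word_class S w) = word_eval G f w" if "w \<in> group_words S" for w
  proof -
    have "word_eval G f ` word_class S w = {word_eval G f w}"
      using that free_rel.refl[OF that] by (auto simp: word_class_def dest: word_eval_free_rel[OF f])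
    then show ?thesis by (simp add: h_def)
  qed
  show "h \<in> hom (free_group S) G"
    by (rule homI) (auto simp: carrier_free_group h f mult_free_group word_eval_append[OF f] word_eval_closed[OF f])
  show "h (free_gen S x) = f x" if "x \<in> S" for x
    using that f by (auto simp: free_gen_def h Pi_iff)
qed

end

section \<open>Normal closures and presentations by epimorphisms\<close>

lemma normal_Inter:
  assumes "group G" "\<And>N. N \<in> \<N> \<Longrightarrow> N \<lhd> G" "\<N> \<noteq> {}"
  shows "\<Inter>\<N> \<lhd> G"
proof -
  interpret group G by fact
  show ?thesis
  proof (rule normal_invI)
    show "subgroup (\<Inter>\<N>) G"
      using assms by (intro subgroups_Inter) (auto intro: normal_imp_subgroup)
    show "x \<otimes>\<^bsub>G\<^esub> h \<otimes>\<^bsub>G\<^esub> inv\<^bsub>G\<^esub> x \<in> \<Inter>\<N>" if "x \<in> carrier G" "h \<in> \<Inter>\<N>" for x h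
      using that assms by (auto intro: normal.inv_op_closed2)
  qed
qed

context group
begin

lemma normal_closure_normal:
  "R \<subseteq> carrier G \<Longrightarrow> normal_closure G R \<lhd> G"
  unfolding normal_closure_def using normal_self by (intro normal_Inter) auto

lemma normal_closure_incl: "R \<subseteq> normal_closure G R"
  by (auto simp: normal_closure_def)

lemma normal_closure_least: "N \<lhd> G \<Longrightarrow> R \<subseteq> N \<Longrightarrow> normal_closure G R \<subseteq> N"
  by (auto simp: normal_closure_def)

end

lemma group_hom_epi: "group G \<Longrightarrow> group H \<Longrightarrow> p \<in> epi G H \<Longrightarrow> group_hom G H p"
  by (simp add: group_hom_def group_hom_axioms_def epi_def)

lemma FactGroup_natural_epi:
  assumes "N \<lhd> G"
  shows "(\<lambda>x. N #>\<^bsub>G\<^esub> x) \<in> epi G (G Mod N)"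
  using normal.r_coset_hom_Mod[OF assms] by (simp add: epi_def carrier_FactGroup)

lemma kernel_FactGroup_natural:
  assumes "N \<lhd> G"
  shows "kernel G (G Mod N) (\<lambda>x. N #>\<^bsub>G\<^esub> x) = N"
proof -
  interpret normal N G by fact
  have "N #>\<^bsub>G\<^esub> x = N \<longleftrightarrow> x \<in> N" if "x \<in> carrier G" for x
    using rcos_self[OF that is_subgroup] rcos_const[OF is_group] by metis
  then show ?thesis
    using subset by (simp add: kernel_def set_eq_iff) blast
qed

text \<open>An epimorphism with prescribed kernel, unlike an isomorphism with a quotient, can be
  composed with further epimorphisms and compared with other homomorphisms on the same free
  group.\<close>

lemma finitely_presented_iff:
  assumes G: "group G"
  shows "finitely_presented G \<longleftrightarrow> (\<exists>(n::nat) R p. finite R \<and> R \<subseteq> carrier (free_group {..<n}) \<and>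
     p \<in> epi (free_group {..<n}) G \<and>
     kernel (free_group {..<n}) G p = normal_closure (free_group {..<n}) R)"
proof
  assume "finitely_presented G"
  then obtain n :: nat and R where R: "finite R" "R \<subseteq> carrier (free_group {..<n})"
    and iso: "G \<cong> free_group {..<n} Mod normal_closure (free_group {..<n}) R"
    by (auto simp: finitely_presented_def)
  let ?F = "free_group {..<n}"
  let ?N = "normal_closure ?F R"
  interpret F: group ?F by simp
  have N: "?N \<lhd> ?F" using R by (simp add: F.normal_closure_normal)
  interpret P: group "?F Mod ?N" using N by (rule normal.factorgroup_is_group)
  obtain g where g: "g \<in> iso (?F Mod ?N) G"
    using group.iso_sym[OF G iso] by (auto simp: is_iso_def)
  let ?p = "g \<circ> (\<lambda>x. ?N #>\<^bsub>?F\<^esub> x)"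
  have "?p \<in> epi ?F G"
    using epi_compose[OF FactGroup_natural_epi[OF N]] g by (auto simp: iso_iff_mon_epi)
  moreover have "kernel ?F G ?p = ?N"
  proof -
    have "g X = \<one>\<^bsub>G\<^esub> \<longleftrightarrow> X = \<one>\<^bsub>?F Mod ?N\<^esub>" if "X \<in> carrier (?F Mod ?N)" for X
    proof -
      have "g \<one>\<^bsub>?F Mod ?N\<^esub> = \<one>\<^bsub>G\<^esub>" 
        using g hom_one[OF _ P.is_group G] by (simp add: iso_def)
      then show ?thesis
        using inj_on_eq_iff[of g "carrier (?F Mod ?N)" X "\<one>\<^bsub>?F Mod ?N\<^esub>"] that g P.one_closed
        by (simp add: iso_iff)
    qed
    then have "kernel ?F G ?p = kernel ?F (?F Mod ?N) (\<lambda>x. ?N #>\<^bsub>?F\<^esub> x)"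
      by (auto simp: kernel_def carrier_FactGroup)
    then show ?thesis using kernel_FactGroup_natural[OF N] by simp
  qed
  ultimately show "\<exists>(n::nat) R p. finite R \<and> R \<subseteq> carrier (free_group {..<n}) \<and>
     p \<in> epi (free_group {..<n}) G \<and>
     kernel (free_group {..<n}) G p = normal_closure (free_group {..<n}) R"
    using R by blast
next
  assume "\<exists>(n::nat) R p. finite R \<and> R \<subseteq> carrier (free_group {..<n}) \<and>
     p \<in> epi (free_group {..<n}) G \<and>
     kernel (free_group {..<n}) G p = normal_closure (free_group {..<n}) R"
  then obtain n :: nat and R p where R: "finite R" "R \<subseteq> carrier (free_group {..<n})"
    "p \<in> epi (free_group {..<n}) G"
    and k: "kernel (free_group {..<n}) G p = normal_closure (free_group {..<n}) R"
    by blast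
  interpret group_hom "free_group {..<n}" G p
    using R G by (simp add: group_hom_epi)
  have "free_group {..<n} Mod normal_closure (free_group {..<n}) R \<cong> G"
    using FactGroup_iso R(3) k by (simp add: epi_def)
  then have "G \<cong> free_group {..<n} Mod normal_closure (free_group {..<n}) R"
    using group.iso_sym[OF normal.factorgroup_is_group[OF normal_kernel]] k by simp
  then show "finitely_presented G"
    using R by (auto simp: finitely_presented_def)
qed

section \<open>The maximal condition on normal subgroups\<close>

text \<open>The equivalence, instead of mere closure, encodes invariance under an automorphism and
  its inverse. For commuting automorphisms of an abelian group these are the submodules over Laurent
  polynomials in the operators.\<close>

definition operator_subgroup :: "('a, 'm) monoid_scheme \<Rightarrow> ('a \<Rightarrow> 'a) set \<Rightarrow> 'a set \<Rightarrow> bool" where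
  "operator_subgroup M T N \<longleftrightarrow> subgroup N M \<and> (\<forall>t\<in>T. \<forall>x\<in>carrier M. t x \<in> N \<longleftrightarrow> x \<in> N)"

definition operator_span :: "('a, 'm) monoid_scheme \<Rightarrow> ('a \<Rightarrow> 'a) set \<Rightarrow> 'a set \<Rightarrow> 'a set" where
  "operator_span M T X = \<Inter>{N. operator_subgroup M T N \<and> X \<subseteq> N}"

text \<open>The ambient group stays fixed while the bound \<open>A\<close> varies; an additional
  operator then enlarges \<open>A\<close> without a change of group.\<close>

definition operator_noetherian :: "('a, 'm) monoid_scheme \<Rightarrow> ('a \<Rightarrow> 'a) set \<Rightarrow> 'a set \<Rightarrow> bool" where
  "operator_noetherian M T A \<longleftrightarrow>
    (\<forall>N::nat \<Rightarrow> 'a set. (\<forall>i. operator_subgroup M T (N i)) \<longrightarrow> incseq N \<longrightarrow> (\<forall>i. N i \<subseteq> A) \<longrightarrow>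
      (\<exists>m. \<forall>i\<ge>m. N i = N m))"

lemma operator_span_least:
  "operator_subgroup M T N \<Longrightarrow> X \<subseteq> N \<Longrightarrow> operator_span M T X \<subseteq> N"
  by (auto simp: operator_span_def)

lemma operator_span_incl: "X \<subseteq> operator_span M T X"
  by (auto simp: operator_span_def)

lemma (in group) operator_subgroup_span:
  assumes T: "\<And>t. t \<in> T \<Longrightarrow> t \<in> hom G G" and X: "X \<subseteq> carrier G"
  shows "operator_subgroup G T (operator_span G T X)"
proof -
  let ?\<N> = "{N. operator_subgroup G T N \<and> X \<subseteq> N}"
  have "carrier G \<in> ?\<N>"
    using hom_in_carrier[OF T] X by (auto simp: operator_subgroup_def subgroup_self)
  then have "subgroup (\<Inter>?\<N>) G"
    by (intro subgroups_Inter) (auto simp: operator_subgroup_def)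
  then show ?thesis
    unfolding operator_subgroup_def operator_span_def by blast
qed

lemma operator_noetherianD:
  assumes "operator_noetherian M T A" "\<And>i. operator_subgroup M T (N i)" "incseq N" "\<And>i. N i \<subseteq> A"
  obtains m where "\<And>i. i \<ge> m \<Longrightarrow> N i = N m"
  using assms unfolding operator_noetherian_def by meson

lemma operator_noetherian_subset:
  "operator_noetherian M T A \<Longrightarrow> B \<subseteq> A \<Longrightarrow> operator_noetherian M T B"
  unfolding operator_noetherian_def by (meson subset_trans)

text \<open>The diagonal becomes constant from some index m on, which settles all rows from m on at
  once. The finitely many rows below m stabilise individually, and \<open>J\<close> is the maximum
  of these bounds.\<close>

lemma operator_noetherian_double_chain:
  fixes L :: "nat \<Rightarrow> nat \<Rightarrow> 'a set"
  assumes noeth: "operator_noetherian M T A"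
    and op: "\<And>i j. operator_subgroup M T (L i j)" and sub: "\<And>i j. L i j \<subseteq> A"
    and mono: "\<And>i i' j j'. i \<le> i' \<Longrightarrow> j \<le> j' \<Longrightarrow> L i j \<subseteq> L i' j'"
  shows "\<exists>J. \<forall>j\<ge>J. \<forall>i. L i j = L i J"
proof -
  have "incseq (\<lambda>i. L i i)" using mono by (simp add: incseq_def)
  then obtain m where m: "\<And>i. i \<ge> m \<Longrightarrow> L i i = L m m"
    using operator_noetherianD[OF noeth, of "\<lambda>i. L i i"] op sub by metis
  have "\<exists>k. \<forall>j\<ge>k. L i j = L i k" for i
  proof -
    have "incseq (L i)" using mono by (simp add: incseq_def)
    then show ?thesis
      using operator_noetherianD[OF noeth, of "L i"] op sub by metis
  qed
  then obtain k where k: "\<And>i j. j \<ge> k i \<Longrightarrow> L i j = L i (k i)" by metis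
  define J where "J = Max (insert m (k ` {..<m}))"
  have J: "m \<le> J" "\<And>i. i < m \<Longrightarrow> k i \<le> J" by (auto simp: J_def)
  have "L i j = L i J" if "j \<ge> J" for i j
  proof (cases "i < m")
    case True
    then show ?thesis using J k that by (metis order_trans)
  next
    case False
    have "L i j' = L m m" if "j' \<ge> J" for j'
    proof
      have "L i j' \<subseteq> L (max i j') (max i j')" by (rule mono) auto
      also have "\<dots> = L m m" using False by (intro m) auto
      finally show "L i j' \<subseteq> L m m" .
      show "L m m \<subseteq> L i j'" using J that False by (intro mono) auto
    qed
    then show ?thesis using that by simp
  qed
  then show ?thesis by blast
qed

section \<open>Hilbert's basis theorem for one additional operator\<close>

text \<open>\<open>A\<close> plays the role of the coefficient module and \<open>t\<close> that of
  the new variable; by \<open>commute\<close>, the powers of \<open>t\<close> are linear over the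
  old operators.\<close>

locale adjoin_operator = comm_group +
  fixes T :: "('a \<Rightarrow> 'a) set" and t :: "'a \<Rightarrow> 'a" and A :: "'a set"
  assumes T_iso: "\<And>s. s \<in> T \<Longrightarrow> s \<in> iso G G" and t_iso: "t \<in> iso G G"
    and commute: "\<And>s x. s \<in> T \<Longrightarrow> x \<in> carrier G \<Longrightarrow> t (s x) = s (t x)"
    and A_op: "operator_subgroup G T A"
begin

lemma A_subgroup: "subgroup A G"
  using A_op by (simp add: operator_subgroup_def)

lemma A_closed [simp]: "a \<in> A \<Longrightarrow> a \<in> carrier G"
  using A_subgroup subgroup.mem_carrier by metis

lemma pow_iso: "t ^^ i \<in> iso G G"
proof (induction i)
  case 0
  then show ?case by (simp add: iso_set_refl id_def)
next
  case (Suc i)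
  then show ?case using iso_set_trans[OF Suc t_iso] by (simp add: o_def)
qed

lemma pow_hom: "t ^^ i \<in> hom G G"
  using pow_iso by (simp add: iso_def)

lemma pow_group_hom: "group_hom G G (t ^^ i)"
  by (simp add: group_hom_def group_hom_axioms_def pow_hom)

lemma T_group_hom: "s \<in> T \<Longrightarrow> group_hom G G s"
  using T_iso by (simp add: group_hom_def group_hom_axioms_def iso_def)

lemmas pow_simps [simp] = group_hom.hom_mult[OF pow_group_hom] group_hom.hom_inv[OF pow_group_hom]
  group_hom.hom_one[OF pow_group_hom] group_hom.hom_closed[OF pow_group_hom]

lemma t_group_hom: "group_hom G G t"
  using pow_group_hom[of 1] by simp

lemmas t_simps [simp] = group_hom.hom_mult[OF t_group_hom] group_hom.hom_inv[OF t_group_hom]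
  group_hom.hom_one[OF t_group_hom] group_hom.hom_closed[OF t_group_hom]

lemmas T_simps [simp] = group_hom.hom_mult[OF T_group_hom] group_hom.hom_inv[OF T_group_hom]
  group_hom.hom_one[OF T_group_hom] group_hom.hom_closed[OF T_group_hom]

lemma T_surj:
  assumes "s \<in> T" "y \<in> carrier G" obtains x where "x \<in> carrier G" "y = s x"
  using T_iso[OF assms(1)] assms(2) by (auto simp: iso_iff)

lemma T_inj: "s \<in> T \<Longrightarrow> x \<in> carrier G \<Longrightarrow> y \<in> carrier G \<Longrightarrow> s x = s y \<longleftrightarrow> x = y"
  using T_iso by (auto simp: iso_iff inj_on_def)

lemma pow_commute: "s \<in> T \<Longrightarrow> x \<in> carrier G \<Longrightarrow> (t ^^ i) (s x) = s ((t ^^ i) x)"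
  by (induction i) (auto simp: commute)

text \<open>Polynomials in \<open>t\<close> of degree strictly less than the index, with
  coefficients in \<open>A\<close>. The strict bound makes the bottom layer trivial, where
  inductions on the degree start.\<close>

fun layer :: "nat \<Rightarrow> 'a set" where
  "layer 0 = {\<one>}"
| "layer (Suc i) = {x \<otimes> (t ^^ i) a | x a. x \<in> layer i \<and> a \<in> A}"

lemma layer_SucI: "x \<in> layer i \<Longrightarrow> a \<in> A \<Longrightarrow> x \<otimes> (t ^^ i) a \<in> layer (Suc i)"
  by auto

lemma layer_op: "operator_subgroup G T (layer i)"
proof (induction i)
  case 0
  have "s x = \<one> \<longleftrightarrow> x = \<one>" if "s \<in> T" "x \<in> carrier G" for s x
    using T_inj[OF that one_closed] that by simp
  then show ?case by (simp add: operator_subgroup_def triv_subgroup)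
next
  case (Suc i)
  then interpret W: subgroup "layer i" G by (simp add: operator_subgroup_def)
  interpret A: subgroup A G by (rule A_subgroup)
  have "subgroup (layer (Suc i)) G"
  proof (rule subgroupI)
    show "layer (Suc i) \<subseteq> carrier G" by auto
    have "\<one> \<otimes> (t ^^ i) \<one> \<in> layer (Suc i)"
      using W.one_closed A.one_closed by (rule layer_SucI)
    then show "layer (Suc i) \<noteq> {}" by blast
    fix y assume "y \<in> layer (Suc i)"
    then obtain x a where y: "y = x \<otimes> (t ^^ i) a" "x \<in> layer i" "a \<in> A" by auto
    then have "inv y = inv x \<otimes> (t ^^ i) (inv a)" by (simp add: inv_mult)
    then show "inv y \<in> layer (Suc i)"
      using layer_SucI[OF W.m_inv_closed[OF y(2)] A.m_inv_closed[OF y(3)]] by (simp only:)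
    fix z assume "z \<in> layer (Suc i)"
    then obtain x' a' where z: "z = x' \<otimes> (t ^^ i) a'" "x' \<in> layer i" "a' \<in> A" by auto
    with y have "y \<otimes> z = (x \<otimes> x') \<otimes> (t ^^ i) (a \<otimes> a')" by (simp add: m_ac)
    then show "y \<otimes> z \<in> layer (Suc i)"
      using layer_SucI[OF W.m_closed[OF y(2) z(2)] A.m_closed[OF y(3) z(3)]] by (simp only:)
  qed
  moreover have "s y \<in> layer (Suc i) \<longleftrightarrow> y \<in> layer (Suc i)" if s: "s \<in> T" and y: "y \<in> carrier G" for s y
  proof
    assume "y \<in> layer (Suc i)"
    then obtain x a where xa: "y = x \<otimes> (t ^^ i) a" "x \<in> layer i" "a \<in> A" by auto
    then have "s y = s x \<otimes> (t ^^ i) (s a)" using s by (simp add: pow_commute)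
    moreover have "s x \<in> layer i" "s a \<in> A"
      using xa Suc A_op s by (auto simp: operator_subgroup_def)
    ultimately show "s y \<in> layer (Suc i)" by auto
  next
    assume "s y \<in> layer (Suc i)"
    then obtain x a where xa: "s y = x \<otimes> (t ^^ i) a" "x \<in> layer i" "a \<in> A" by auto
    obtain x' where x': "x' \<in> carrier G" "x = s x'" using T_surj[OF s W.mem_carrier[OF xa(2)]] .
    obtain a' where a': "a' \<in> carrier G" "a = s a'" using T_surj[OF s A_closed[OF xa(3)]] .
    have "s y = s (x' \<otimes> (t ^^ i) a')" using xa x' a' s by (simp add: pow_commute)
    moreover have "x' \<otimes> (t ^^ i) a' \<in> carrier G" using x' a' by simp
    ultimately have "y = x' \<otimes> (t ^^ i) a'" using T_inj[OF s y] by blast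
    moreover have "x' \<in> layer i" "a' \<in> A"
      using xa x' a' Suc A_op s by (auto simp: operator_subgroup_def)
    ultimately show "y \<in> layer (Suc i)" by auto
  qed
  ultimately show ?case unfolding operator_subgroup_def by blast
qed

lemma layer_subgroup: "subgroup (layer i) G"
  using layer_op by (simp add: operator_subgroup_def)

lemma layer_closed [simp]: "x \<in> layer i \<Longrightarrow> x \<in> carrier G"
  using layer_subgroup subgroup.mem_carrier by metis

lemma layer_incseq: "incseq layer"
proof (rule incseq_SucI)
  fix i
  have "x \<otimes> (t ^^ i) \<one> = x" if "x \<in> layer i" for x using that by simp
  then show "layer i \<subseteq> layer (Suc i)"
    using subgroup.one_closed[OF A_subgroup] by force
qed

lemma t_layer: "x \<in> layer i \<Longrightarrow> t x \<in> layer (Suc i)"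
proof (induction i arbitrary: x)
  case 0
  then show ?case
    using subgroup.one_closed[OF A_subgroup] by (auto intro!: exI[of _ \<one>])
next
  case (Suc i)
  then obtain y a where "x = y \<otimes> (t ^^ i) a" "y \<in> layer i" "a \<in> A" by auto
  moreover from this have "t x = t y \<otimes> (t ^^ Suc i) a" by simp
  ultimately show ?case using Suc.IH by (subst layer.simps) blast
qed

declare layer.simps(2) [simp del]

lemma pow_layer: "x \<in> layer i \<Longrightarrow> (t ^^ k) x \<in> layer (i + k)"
  by (induction k) (auto intro: t_layer)

lemma span_layer:
  assumes "y \<in> operator_span G (insert t T) A"
  obtains k i where "(t ^^ k) y \<in> layer i"
proof -
  \<comment> \<open>The elements that some power of \<open>t\<close> turns into a polynomial. This
    set is an operator subgroup containing \<open>A\<close>, hence contains the span.\<close>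
  let ?C = "{y \<in> carrier G. \<exists>k i. (t ^^ k) y \<in> layer i}"
  have "subgroup ?C G"
  proof (rule subgroupI)
    have "(t ^^ 0) \<one> \<in> layer 0" by simp
    then have "\<one> \<in> ?C" by blast
    then show "?C \<noteq> {}" by blast
    fix x assume x: "x \<in> ?C"
    then obtain k i where ki: "(t ^^ k) x \<in> layer i" by auto
    then have "(t ^^ k) (inv x) \<in> layer i"
      using x subgroup.m_inv_closed[OF layer_subgroup] by simp
    then show "inv x \<in> ?C" using x by blast
    fix y assume y: "y \<in> ?C"
    then obtain k' i' where ki': "(t ^^ k') y \<in> layer i'" by auto
    have "(t ^^ (k' + k)) x \<in> layer (i + k')" "(t ^^ (k + k')) y \<in> layer (i' + k)"
      using pow_layer[OF ki, of k'] pow_layer[OF ki', of k] by (simp_all add: funpow_add)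
    then have "(t ^^ (k + k')) x \<in> layer (i + k' + (i' + k))" "(t ^^ (k + k')) y \<in> layer (i + k' + (i' + k))"
      using incseqD[OF layer_incseq, of "i + k'" "i + k' + (i' + k)"]
        incseqD[OF layer_incseq, of "i' + k" "i + k' + (i' + k)"] by (auto simp: add.commute)
    then have "(t ^^ (k + k')) (x \<otimes> y) \<in> layer (i + k' + (i' + k))"
      using x y subgroup.m_closed[OF layer_subgroup] by simp
    then show "x \<otimes> y \<in> ?C" using x y by blast
  qed auto
  moreover have "s y \<in> ?C \<longleftrightarrow> y \<in> ?C" if "s \<in> insert t T" "y \<in> carrier G" for s y
  proof (cases "s = t")
    case True
    have "(t ^^ k) (t y) \<in> layer (Suc i)" if "(t ^^ k) y \<in> layer i" for k i
      using t_layer[OF that] by (simp add: funpow_swap1)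
    moreover have "(t ^^ Suc k) y \<in> layer i" if "(t ^^ k) (t y) \<in> layer i" for k i
      using that by (simp add: funpow_swap1)
    ultimately have "(\<exists>k i. (t ^^ k) (t y) \<in> layer i) \<longleftrightarrow> (\<exists>k i. (t ^^ k) y \<in> layer i)"
      by meson
    then show ?thesis using that True by simp
  next
    case False
    then show ?thesis
      using that layer_op by (simp add: pow_commute operator_subgroup_def)
  qed
  ultimately have "operator_subgroup G (insert t T) ?C"
    unfolding operator_subgroup_def by blast
  moreover have "A \<subseteq> ?C"
  proof
    fix a assume a: "a \<in> A"
    then have "(t ^^ 0) a \<in> layer (Suc 0)" using layer_SucI[of \<one> 0 a] by simp
    then show "a \<in> ?C" using A_closed[OF a] by blast
  qed
  ultimately have "y \<in> ?C"
    using assms operator_span_least by blast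
  then show ?thesis using that by auto
qed

text \<open>The coefficients of \<open>t ^^ i\<close> in elements of \<open>N\<close> of degree at most \<open>i\<close>, as in Hilbert's basis
  theorem; expansions in powers of \<open>t\<close> need not be unique here.\<close>

definition leading :: "nat \<Rightarrow> 'a set \<Rightarrow> 'a set" where
  "leading i N = {a \<in> A. \<exists>x\<in>layer i. x \<otimes> (t ^^ i) a \<in> N}"

lemma leading_op:
  assumes "operator_subgroup G T N"
  shows "operator_subgroup G T (leading i N)"
proof -
  interpret N: subgroup N G using assms by (simp add: operator_subgroup_def)
  interpret W: subgroup "layer i" G by (rule layer_subgroup)
  interpret A: subgroup A G by (rule A_subgroup)
  have "subgroup (leading i N) G"
  proof (rule subgroupI)
    show "leading i N \<subseteq> carrier G" by (auto simp: leading_def)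
    have "\<one> \<in> leading i N" 
      unfolding leading_def using W.one_closed by (intro CollectI conjI bexI[of _ \<one>]) simp_all
    then show "leading i N \<noteq> {}" by blast
    fix a assume "a \<in> leading i N"
    then obtain x where x: "a \<in> A" "x \<in> layer i" "x \<otimes> (t ^^ i) a \<in> N"
      by (auto simp: leading_def)
    then have "inv x \<otimes> (t ^^ i) (inv a) = inv (x \<otimes> (t ^^ i) a)" by (simp add: inv_mult)
    then have "inv x \<otimes> (t ^^ i) (inv a) \<in> N" using N.m_inv_closed[OF x(3)] by (simp only:)
    then show "inv a \<in> leading i N"
      unfolding leading_def using W.m_inv_closed[OF x(2)] A.m_inv_closed[OF x(1)] by blast
    fix b assume "b \<in> leading i N"
    then obtain y where y: "b \<in> A" "y \<in> layer i" "y \<otimes> (t ^^ i) b \<in> N"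
      by (auto simp: leading_def)
    have "(x \<otimes> y) \<otimes> (t ^^ i) (a \<otimes> b) = (x \<otimes> (t ^^ i) a) \<otimes> (y \<otimes> (t ^^ i) b)"
      using x y by (simp add: m_ac)
    then have "(x \<otimes> y) \<otimes> (t ^^ i) (a \<otimes> b) \<in> N" using N.m_closed[OF x(3) y(3)] by (simp only:)
    then show "a \<otimes> b \<in> leading i N"
      unfolding leading_def using W.m_closed[OF x(2) y(2)] A.m_closed[OF x(1) y(1)] by blast
  qed
  moreover have "s a \<in> leading i N \<longleftrightarrow> a \<in> leading i N" if s: "s \<in> T" and a: "a \<in> carrier G" for s a
  proof -
    \<comment> \<open>An old operator permutes each layer, so the lower terms may be assumed to have
      the form \<open>s x\<close>; then \<open>s\<close> can be pulled out of the whole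
      expression.\<close>
    have "(\<exists>x\<in>layer i. x \<otimes> (t ^^ i) (s a) \<in> N) \<longleftrightarrow> (\<exists>x\<in>layer i. s x \<otimes> (t ^^ i) (s a) \<in> N)"
    proof
      assume "\<exists>x\<in>layer i. x \<otimes> (t ^^ i) (s a) \<in> N"
      then obtain x where x: "x \<in> layer i" "x \<otimes> (t ^^ i) (s a) \<in> N" by blast
      obtain x' where x': "x' \<in> carrier G" "x = s x'"
        using T_surj[OF s layer_closed[OF x(1)]] .
      then have "x' \<in> layer i"
        using x layer_op[of i] s by (simp add: operator_subgroup_def)
      then show "\<exists>x\<in>layer i. s x \<otimes> (t ^^ i) (s a) \<in> N"
        using x x' by blast
    next
      assume "\<exists>x\<in>layer i. s x \<otimes> (t ^^ i) (s a) \<in> N"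
      then obtain x where x: "x \<in> layer i" "s x \<otimes> (t ^^ i) (s a) \<in> N" by blast
      have "s x \<in> layer i"
        using x layer_op[of i] s by (simp add: operator_subgroup_def)
      then show "\<exists>x\<in>layer i. x \<otimes> (t ^^ i) (s a) \<in> N"
        using x by blast
    qed
    also have "\<dots> \<longleftrightarrow> (\<exists>x\<in>layer i. s (x \<otimes> (t ^^ i) a) \<in> N)"
    proof (rule bex_cong[OF HOL.refl])
      fix x assume "x \<in> layer i"
      then show "s x \<otimes> (t ^^ i) (s a) \<in> N \<longleftrightarrow> s (x \<otimes> (t ^^ i) a) \<in> N"
        using s a by (simp add: pow_commute)
    qed
    also have "\<dots> \<longleftrightarrow> (\<exists>x\<in>layer i. x \<otimes> (t ^^ i) a \<in> N)"
    proof (rule bex_cong[OF HOL.refl])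
      fix x assume "x \<in> layer i"
      then have "x \<otimes> (t ^^ i) a \<in> carrier G" using a by simp
      then show "s (x \<otimes> (t ^^ i) a) \<in> N \<longleftrightarrow> x \<otimes> (t ^^ i) a \<in> N"
        using s assms by (simp only: operator_subgroup_def)
    qed
    finally have "(\<exists>x\<in>layer i. x \<otimes> (t ^^ i) (s a) \<in> N) \<longleftrightarrow> (\<exists>x\<in>layer i. x \<otimes> (t ^^ i) a \<in> N)" .
    moreover have "s a \<in> A \<longleftrightarrow> a \<in> A"
      using s a A_op by (simp add: operator_subgroup_def)
    ultimately show ?thesis
      unfolding leading_def by blast
  qed
  ultimately show ?thesis unfolding operator_subgroup_def by blast
qed

lemma leading_mono: "N \<subseteq> N' \<Longrightarrow> leading i N \<subseteq> leading i N'"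
  by (auto simp: leading_def)

text \<open>Applying \<open>t\<close> raises the degree by one and keeps the leading
  coefficient.\<close>

lemma leading_incseq:
  assumes N: "operator_subgroup G (insert t T) N"
  shows "incseq (\<lambda>i. leading i N)"
proof (rule incseq_SucI)
  fix i
  show "leading i N \<subseteq> leading (Suc i) N"
  proof
    fix a assume "a \<in> leading i N"
    then obtain x where x: "a \<in> A" "x \<in> layer i" "x \<otimes> (t ^^ i) a \<in> N"
      by (auto simp: leading_def)
    then have "t x \<otimes> (t ^^ Suc i) a = t (x \<otimes> (t ^^ i) a)" by simp
    moreover have "t (x \<otimes> (t ^^ i) a) \<in> N"
      using N x subgroup.mem_carrier[of N G] unfolding operator_subgroup_def by blast
    ultimately have "t x \<otimes> (t ^^ Suc i) a \<in> N" by metis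
    then show "a \<in> leading (Suc i) N"
      unfolding leading_def using x t_layer by blast
  qed
qed

text \<open>Induction on the degree: an element of \<open>N'\<close> has the same leading term as
  some element of \<open>N\<close>, and their quotient lies in \<open>N'\<close> and has smaller
  degree. Arbitrary elements are first moved into a layer by a power of \<open>t\<close>, which
  changes membership in neither subgroup.\<close>

lemma eq_if_leading_eq:
  assumes N: "operator_subgroup G (insert t T) N" and N': "operator_subgroup G (insert t T) N'"
    and sub: "N \<subseteq> N'" "N' \<subseteq> operator_span G (insert t T) A"
    and eq: "\<And>i. leading i N' = leading i N"
  shows "N' = N"
proof
  interpret N: subgroup N G using N by (simp add: operator_subgroup_def)
  interpret N': subgroup N' G using N' by (simp add: operator_subgroup_def)
  have layer: "y \<in> N" if "y \<in> layer i" "y \<in> N'" for i y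
    using that
  proof (induction i arbitrary: y)
    case (Suc i)
    then obtain x a where y: "y = x \<otimes> (t ^^ i) a" "x \<in> layer i" "a \<in> A"
      by (auto simp: layer.simps(2))
    then have "a \<in> leading i N'" using Suc.prems by (auto simp: leading_def)
    then have "a \<in> leading i N" using eq by simp
    then obtain x' where x': "x' \<in> layer i" "x' \<otimes> (t ^^ i) a \<in> N" by (auto simp: leading_def)
    have eq: "x \<otimes> inv x' = y \<otimes> inv (x' \<otimes> (t ^^ i) a)"
      using y x' by (simp add: inv_mult_group m_assoc) (simp flip: m_assoc)
    have "y \<otimes> inv (x' \<otimes> (t ^^ i) a) \<in> N'"
      using Suc.prems x' sub by blast
    moreover have "x \<otimes> inv x' \<in> layer i"
      using y x' subgroup.m_closed[OF layer_subgroup] subgroup.m_inv_closed[OF layer_subgroup] by blast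
    ultimately have "x \<otimes> inv x' \<in> N"
      using Suc.IH eq by metis
    then have "(x \<otimes> inv x') \<otimes> (x' \<otimes> (t ^^ i) a) \<in> N" using x' by blast
    moreover have "(x \<otimes> inv x') \<otimes> (x' \<otimes> (t ^^ i) a) = y"
      using eq y x' Suc.prems by (simp add: m_assoc)
    ultimately show ?case by simp
  qed (use N.one_closed in simp)
  show "N' \<subseteq> N"
  proof
    fix y assume y: "y \<in> N'"
    then obtain k i where ki: "(t ^^ k) y \<in> layer i"
      using sub span_layer by blast
    have pow: "(t ^^ k) y \<in> K \<longleftrightarrow> y \<in> K" if "operator_subgroup G (insert t T) K" for k K
      using that y by (induction k) (auto simp: operator_subgroup_def)
    have "(t ^^ k) y \<in> N'" using pow[OF N'] y by simp
    then have "(t ^^ k) y \<in> N" using ki layer by blast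
    then show "y \<in> N" using pow[OF N] by simp
  qed
qed (rule sub)

text \<open>The leading coefficients form a family that increases both in the degree and along the
  chain. Beyond the column where all degrees are stationary, \<open>eq_if_leading_eq\<close>
  identifies the members of the chain.\<close>

lemma noetherian_span:
  assumes "operator_noetherian G T A"
  shows "operator_noetherian G (insert t T) (operator_span G (insert t T) A)"
  unfolding operator_noetherian_def
proof (intro allI impI)
  fix N :: "nat \<Rightarrow> 'a set"
  assume N: "\<forall>i. operator_subgroup G (insert t T) (N i)" "incseq N"
    "\<forall>i. N i \<subseteq> operator_span G (insert t T) A"
  then have op: "operator_subgroup G T (leading i (N j))" for i j
    by (intro leading_op) (auto simp: operator_subgroup_def)
  have mono: "leading i (N j) \<subseteq> leading i' (N j')" if "i \<le> i'" "j \<le> j'" for i i' j j'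
  proof -
    have "leading i (N j) \<subseteq> leading i (N j')"
      using incseqD[OF N(2) that(2)] by (rule leading_mono)
    also have "\<dots> \<subseteq> leading i' (N j')"
      using incseqD[OF leading_incseq] N that by blast
    finally show ?thesis .
  qed
  have sub: "leading i (N j) \<subseteq> A" for i j by (auto simp: leading_def)
  obtain J where J: "\<forall>j\<ge>J. \<forall>i. leading i (N j) = leading i (N J)"
    using operator_noetherian_double_chain[of G T A "\<lambda>i j. leading i (N j)", OF assms op sub mono] ..
  have "N j = N J" if "j \<ge> J" for j
  proof (rule eq_if_leading_eq)
    show "N J \<subseteq> N j" using N(2) that by (rule incseqD)
    show "leading i (N j) = leading i (N J)" for i using J that by blast
  qed (use N in blast)+
  then show "\<exists>m. \<forall>i\<ge>m. N i = N m" by blast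
qed

end

section \<open>Modules without and with finitely many operators\<close>

text \<open>Let d be the least positive element of the union. As soon as d has entered the chain,
  division with remainder shows that every further member consists of multiples of d.\<close>

lemma int_subgroup_chain_stabilizes:
  fixes I :: "nat \<Rightarrow> int set"
  assumes sg: "\<And>i. subgroup (I i) integer_group" and inc: "incseq I"
  shows "\<exists>m. \<forall>i\<ge>m. I i = I m"
proof (cases "\<exists>k>0. k \<in> (\<Union>i. I i)")
  case False
  have "I i = {0}" for i
  proof -
    interpret subgroup "I i" integer_group by (rule sg)
    have "k = 0" if "k \<in> I i" for k
      using False that m_inv_closed[OF that] by (cases k "0::int" rule: linorder_cases) force+
    then show ?thesis using one_closed by auto
  qed
  then show ?thesis by blast
next
  case True
  let ?P = "\<lambda>n. n > 0 \<and> int n \<in> (\<Union>i. I i)"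
  define d where "d = (LEAST n. ?P n)"
  have "\<exists>n. ?P n"
  proof -
    obtain k where "k > 0" "k \<in> (\<Union>i. I i)" using True by blast
    then show ?thesis by (intro exI[of _ "nat k"]) auto
  qed
  then have d: "?P d" unfolding d_def by (rule LeastI_ex)
  then obtain m where m: "int d \<in> I m" by blast
  have "I i = I m" if "i \<ge> m" for i
  proof
    interpret Ii: subgroup "I i" integer_group by (rule sg)
    interpret Im: subgroup "I m" integer_group by (rule sg)
    have mult: "j * k \<in> H" if "subgroup H integer_group" "k \<in> H" for j k :: int and H
      using group.subgroup_int_pow_closed[OF group_integer_group that, of j] by simp
    show "I m \<subseteq> I i" using inc that by (rule incseqD)
    show "I i \<subseteq> I m"
    proof
      fix k assume k: "k \<in> I i"
      have "int d \<in> I i" using m \<open>I m \<subseteq> I i\<close> by blast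
      then have "k + - (k div int d) * int d \<in> I i"
        using Ii.m_closed[OF k mult[OF sg, of "int d" i "- (k div int d)"]] by simp
      then have mod: "k mod int d \<in> I i"
        by (simp add: minus_div_mult_eq_mod)
      have "k mod int d = 0"
      proof (rule ccontr)
        assume "k mod int d \<noteq> 0"
        moreover have "0 \<le> k mod int d" "k mod int d < int d" using d by auto
        ultimately have "?P (nat (k mod int d))" "nat (k mod int d) < d" using mod by auto
        then show False unfolding d_def using not_less_Least by blast
      qed
      then have "k = (k div int d) * int d" by auto
      then show "k \<in> I m" using mult[OF sg m] by metis
    qed
  qed
  then show ?thesis by blast
qed

text \<open>Induction on the generators. A chain is determined by its traces on the subgroup of the
  old generators and by the exponents of the new one, two chains that stabilise.\<close>

lemma (in comm_group) noetherian_generate: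
  assumes "finite X" "X \<subseteq> carrier G"
  shows "operator_noetherian G {} (generate G X)"
  using assms
proof (induction X rule: finite_induct)
  case empty
  have "N = {\<one>}" if "subgroup N G" "N \<subseteq> generate G {}" for N
    using that subgroup.one_closed by (auto simp: generate_empty)
  then show ?case
    unfolding operator_noetherian_def operator_subgroup_def by metis
next
  case (insert x X)
  let ?A = "generate G X"
  have x: "x \<in> carrier G" and X: "X \<subseteq> carrier G" using insert by auto
  interpret A: subgroup ?A G using X by (rule generate_is_subgroup)
  have decomp: "\<exists>k::int. \<exists>a\<in>?A. y = x [^] k \<otimes> a" if "y \<in> generate G (insert x X)" for y
  proof -
    let ?B = "{x [^] (k::int) \<otimes> a | k a. a \<in> ?A}"
    have "subgroup ?B G"
    proof (rule subgroupI)
      show "?B \<subseteq> carrier G" using x by auto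
      show "?B \<noteq> {}" using generate.one[of G X] by blast
      fix y assume "y \<in> ?B"
      then obtain k :: int and a where y: "y = x [^] k \<otimes> a" "a \<in> ?A" by auto
      then have "inv y = x [^] (- k) \<otimes> inv a" using x by (simp add: inv_mult int_pow_neg)
      then show "inv y \<in> ?B" using y by blast
      fix z assume "z \<in> ?B"
      then obtain l :: int and b where z: "z = x [^] l \<otimes> b" "b \<in> ?A" by auto
      then have "y \<otimes> z = x [^] (k + l) \<otimes> (a \<otimes> b)" using x y by (simp add: int_pow_mult m_ac)
      then show "y \<otimes> z \<in> ?B" using y z by blast
    qed
    moreover have "x \<in> ?B" using x by (auto intro!: exI[of _ 1] exI[of _ \<one>])
    moreover have "X \<subseteq> ?B" using X generate.incl[of _ X G] by (force intro!: exI[of _ "0::int"])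
    ultimately have "y \<in> ?B" using that generate_subgroup_incl[of "insert x X" ?B] by blast
    then show ?thesis by blast
  qed
  show ?case
    unfolding operator_noetherian_def
  proof (intro allI impI)
    fix N :: "nat \<Rightarrow> 'a set"
    assume N: "\<forall>i. operator_subgroup G {} (N i)" "incseq N" "\<forall>i. N i \<subseteq> generate G (insert x X)"
    then have Nsub: "subgroup (N i) G" for i by (simp add: operator_subgroup_def)
    have "operator_subgroup G {} (N i \<inter> ?A)" for i
      using subgroups_Inter_pair[OF Nsub A.is_subgroup] by (simp add: operator_subgroup_def)
    moreover have "incseq (\<lambda>i. N i \<inter> ?A)" using N(2) by (auto simp: incseq_def)
    ultimately obtain m1 where m1: "\<And>i. i \<ge> m1 \<Longrightarrow> N i \<inter> ?A = N m1 \<inter> ?A"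
      using operator_noetherianD[OF insert.IH[OF X], of "\<lambda>i. N i \<inter> ?A"] by auto
    \<comment> \<open>This replaces the image in the cyclic quotient by \<open>?A\<close>. Exponents
      need not be unique, since a power of \<open>x\<close> may lie in \<open>?A\<close>.\<close>
    define I where "I i = {k::int. \<exists>a\<in>?A. x [^] k \<otimes> a \<in> N i}" for i
    have "subgroup (I i) integer_group" for i
    proof (rule group.subgroupI[OF group_integer_group])
      interpret N: subgroup "N i" G by (rule Nsub)
      show "I i \<noteq> {}" unfolding I_def by (auto intro!: exI[of _ 0] bexI[of _ \<one>])
      fix k assume "k \<in> I i"
      then obtain a where a: "a \<in> ?A" "x [^] k \<otimes> a \<in> N i" by (auto simp: I_def)
      have "x [^] (- k) \<otimes> inv a = inv (x [^] k \<otimes> a)" using a x by (simp add: inv_mult int_pow_neg)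
      also have "\<dots> \<in> N i" using a by blast
      finally show "inv\<^bsub>integer_group\<^esub> k \<in> I i" using a by (auto simp: I_def)
      fix l assume "l \<in> I i"
      then obtain b where b: "b \<in> ?A" "x [^] l \<otimes> b \<in> N i" by (auto simp: I_def)
      have "x [^] (k + l) \<otimes> (a \<otimes> b) = (x [^] k \<otimes> a) \<otimes> (x [^] l \<otimes> b)"
        using a b x by (simp add: int_pow_mult m_ac)
      also have "\<dots> \<in> N i" using a b by blast
      finally show "k \<otimes>\<^bsub>integer_group\<^esub> l \<in> I i" using a b by (auto simp: I_def)
    qed auto
    moreover have "incseq I" using N(2) by (auto simp: incseq_def I_def)
    ultimately obtain m2 where m2: "\<forall>i\<ge>m2. I i = I m2"
      using int_subgroup_chain_stabilizes[of I] by blast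
    let ?m = "max m1 m2"
    have "N i = N ?m" if "i \<ge> ?m" for i
    proof
      interpret Ni: subgroup "N i" G by (rule Nsub)
      interpret Nm: subgroup "N ?m" G by (rule Nsub)
      show sub: "N ?m \<subseteq> N i" using N(2) that by (rule incseqD)
      show "N i \<subseteq> N ?m"
      proof
        fix y assume y: "y \<in> N i"
        then obtain k :: int and a where a: "a \<in> ?A" "y = x [^] k \<otimes> a" using N(3) decomp by blast
        then have "k \<in> I i" using y by (auto simp: I_def)
        moreover have "i \<ge> m2" "?m \<ge> m2" using that by auto
        then have "I i = I m2" "I ?m = I m2" using m2 by blast+
        ultimately have "k \<in> I ?m" by blast
        then obtain b where b: "b \<in> ?A" "x [^] k \<otimes> b \<in> N ?m" by (auto simp: I_def)
        have "y \<otimes> inv (x [^] k \<otimes> b) = a \<otimes> inv b"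
        proof -
          have "y \<otimes> inv (x [^] k \<otimes> b) = (x [^] k \<otimes> inv (x [^] k)) \<otimes> (a \<otimes> inv b)"
            using a b x by (simp add: inv_mult m_ac del: r_inv l_inv)
          then show ?thesis using a b x by simp
        qed
        moreover have "y \<otimes> inv (x [^] k \<otimes> b) \<in> N i" using y b sub by blast
        ultimately have "a \<otimes> inv b \<in> N i \<inter> ?A" using a b by auto
        then have "a \<otimes> inv b \<in> N ?m" using m1[of i] m1[of ?m] that by auto
        then have "(a \<otimes> inv b) \<otimes> (x [^] k \<otimes> b) \<in> N ?m" using b by blast
        moreover have "(a \<otimes> inv b) \<otimes> (x [^] k \<otimes> b) = y"
        proof -
          have swap: "(u \<otimes> v) \<otimes> (w \<otimes> z) = (z \<otimes> v) \<otimes> (w \<otimes> u)"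
            if "u \<in> carrier G" "v \<in> carrier G" "w \<in> carrier G" "z \<in> carrier G" for u v w z
            using that by (simp add: m_ac)
          have "(a \<otimes> inv b) \<otimes> (x [^] k \<otimes> b) = (b \<otimes> inv b) \<otimes> (x [^] k \<otimes> a)"
            using swap[of a "inv b" "x [^] k" b] a b x by simp
          then show ?thesis using a b x by simp
        qed
        ultimately show "y \<in> N ?m" by simp
      qed
    qed
    then show "\<exists>m. \<forall>i\<ge>m. N i = N m" by blast
  qed
qed

lemma (in group) operator_span_empty:
  assumes "X \<subseteq> carrier G"
  shows "operator_span G {} X = generate G X"
proof
  show "operator_span G {} X \<subseteq> generate G X"
    using assms generate_is_subgroup
    by (intro operator_span_least) (auto simp: operator_subgroup_def intro: generate.incl)
  show "generate G X \<subseteq> operator_span G {} X"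
    using operator_subgroup_span[of "{}" X] assms operator_span_incl[of X G "{}"]
    by (intro generate_subgroup_incl) (simp_all add: operator_subgroup_def)
qed

text \<open>The basis theorem applied to one operator at a time, starting from a finitely generated
  abelian group.\<close>

theorem (in comm_group) noetherian_operator_span:
  assumes "finite T" "\<And>t. t \<in> T \<Longrightarrow> t \<in> iso G G"
    and "\<And>s t x. s \<in> T \<Longrightarrow> t \<in> T \<Longrightarrow> x \<in> carrier G \<Longrightarrow> t (s x) = s (t x)"
    and X: "finite X" "X \<subseteq> carrier G"
  shows "operator_noetherian G T (operator_span G T X)"
  using assms(1-3)
proof (induction T rule: finite_induct)
  case empty
  then show ?case using noetherian_generate[OF X] operator_span_empty[OF X(2)] by simp
next
  case (insert t T)
  let ?A = "operator_span G T X"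
  have op: "operator_subgroup G T ?A"
    using insert.prems X by (intro operator_subgroup_span) (auto simp: iso_def)
  interpret adjoin_operator G T t ?A
    by unfold_locales (use insert.prems op in auto)
  have "operator_noetherian G (insert t T) (operator_span G (insert t T) ?A)"
    using insert by (intro noetherian_span) auto
  moreover have "operator_span G (insert t T) X \<subseteq> operator_span G (insert t T) ?A"
  proof (rule operator_span_least)
    show "operator_subgroup G (insert t T) (operator_span G (insert t T) ?A)"
      using insert.prems op by (intro operator_subgroup_span) (auto simp: iso_def)
    show "X \<subseteq> operator_span G (insert t T) ?A"
      using operator_span_incl subset_trans by metis
  qed
  ultimately show ?case by (rule operator_noetherian_subset)
qed

section \<open>Centralisers, conjugation and commutators\<close>

lemma (in group) generate_commute:
  assumes X: "X \<subseteq> carrier G" and comm: "\<And>x y. x \<in> X \<Longrightarrow> y \<in> X \<Longrightarrow> x \<otimes> y = y \<otimes> x"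
    and x: "x \<in> generate G X" and y: "y \<in> generate G X"
  shows "x \<otimes> y = y \<otimes> x"
proof -
  let ?C = "\<lambda>Z. {x \<in> carrier G. \<forall>z\<in>Z. x \<otimes> z = z \<otimes> x}"
  have centralizer: "subgroup (?C Z) G" if Z: "Z \<subseteq> carrier G" for Z
  proof (rule subgroupI)
    have "\<one> \<in> ?C Z" using Z by auto
    then show "?C Z \<noteq> {}" by blast
    fix a assume a: "a \<in> ?C Z"
    have "inv a \<otimes> z = z \<otimes> inv a" if "z \<in> Z" for z
    proof -
      have z: "z \<in> carrier G" and az: "a \<otimes> z = z \<otimes> a" using a that Z by auto
      have "inv a \<otimes> z = inv a \<otimes> (z \<otimes> a) \<otimes> inv a" using a z by (simp add: m_assoc)
      also have "\<dots> = inv a \<otimes> (a \<otimes> z) \<otimes> inv a" using az by simp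
      also have "\<dots> = z \<otimes> inv a" using a z by (simp flip: m_assoc)
      finally show ?thesis .
    qed
    then show "inv a \<in> ?C Z" using a by auto
    fix b assume b: "b \<in> ?C Z"
    have "a \<otimes> b \<otimes> z = z \<otimes> (a \<otimes> b)" if "z \<in> Z" for z
    proof -
      have z: "z \<in> carrier G" and az: "a \<otimes> z = z \<otimes> a" and bz: "b \<otimes> z = z \<otimes> b"
        using a b that Z by auto
      have "a \<otimes> b \<otimes> z = a \<otimes> (z \<otimes> b)" using a b z bz by (simp add: m_assoc)
      also have "\<dots> = z \<otimes> a \<otimes> b" using a b z az by (simp flip: m_assoc)
      finally show ?thesis using a b z by (simp add: m_assoc)
    qed
    then show "a \<otimes> b \<in> ?C Z" using a b by auto
  qed auto
  have "generate G X \<subseteq> ?C X"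
    using X comm by (intro generate_subgroup_incl centralizer) auto
  \<comment> \<open>The relation of commuting is symmetric, so the centraliser argument can be
    repeated with the whole generated subgroup in place of \<open>X\<close>.\<close>
  then have "X \<subseteq> ?C (generate G X)" using X by fastforce
  then have "generate G X \<subseteq> ?C (generate G X)"
    using generate_incl[OF X] by (intro generate_subgroup_incl[of _ "?C (generate G X)"] centralizer)
  then show ?thesis using x y by blast
qed

lemma (in group) inv_mult_cancel:
  assumes "x \<in> carrier G" "y \<in> carrier G"
  shows "inv x \<otimes> (x \<otimes> y) = y" "x \<otimes> (inv x \<otimes> y) = y"
  using assms by (simp_all flip: m_assoc)

definition (in group) conjugate :: "'a \<Rightarrow> 'a \<Rightarrow> 'a" where
  "conjugate g x = g \<otimes> x \<otimes> inv g"

context group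
begin

lemma conjugate_closed [simp]:
  "g \<in> carrier G \<Longrightarrow> x \<in> carrier G \<Longrightarrow> conjugate g x \<in> carrier G"
  by (simp add: conjugate_def)

lemma conjugate_mult:
  "g \<in> carrier G \<Longrightarrow> x \<in> carrier G \<Longrightarrow> y \<in> carrier G \<Longrightarrow>
    conjugate g (x \<otimes> y) = conjugate g x \<otimes> conjugate g y"
  by (simp add: conjugate_def m_assoc inv_solve_left)

lemma conjugate_conjugate:
  "g \<in> carrier G \<Longrightarrow> h \<in> carrier G \<Longrightarrow> x \<in> carrier G \<Longrightarrow>
    conjugate g (conjugate h x) = conjugate (g \<otimes> h) x"
  by (simp add: conjugate_def m_assoc inv_mult_group)

lemma conjugate_one [simp]: "x \<in> carrier G \<Longrightarrow> conjugate \<one> x = x"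
  by (simp add: conjugate_def)

lemma conjugate_inv [simp]:
  "g \<in> carrier G \<Longrightarrow> x \<in> carrier G \<Longrightarrow> conjugate (inv g) (conjugate g x) = x"
  "g \<in> carrier G \<Longrightarrow> x \<in> carrier G \<Longrightarrow> conjugate g (conjugate (inv g) x) = x"
  by (simp_all add: conjugate_conjugate)

lemma conjugate_eq_self:
  "g \<in> carrier G \<Longrightarrow> x \<in> carrier G \<Longrightarrow> g \<otimes> x = x \<otimes> g \<Longrightarrow> conjugate g x = x"
  by (simp add: conjugate_def m_assoc)

lemma normal_conjugate_iff:
  assumes "N \<lhd> G" "g \<in> carrier G" "x \<in> carrier G"
  shows "conjugate g x \<in> N \<longleftrightarrow> x \<in> N"
proof
  assume "conjugate g x \<in> N"
  then have "conjugate (inv g) (conjugate g x) \<in> N"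
    unfolding conjugate_def[of "inv g"] using assms by (intro normal.inv_op_closed2) auto
  then show "x \<in> N" using assms by simp
next
  show "x \<in> N \<Longrightarrow> conjugate g x \<in> N"
    unfolding conjugate_def using assms by (intro normal.inv_op_closed2)
qed

text \<open>Used to pass from generators to all elements. The equivalence yields closure under
  inverses, whereas conjugation could map an infinite \<open>E\<close> properly into itself.\<close>

lemma normalizer_subgroup:
  assumes D: "D \<subseteq> carrier G" "\<And>g x. g \<in> carrier G \<Longrightarrow> x \<in> D \<Longrightarrow> conjugate g x \<in> D"
  shows "subgroup {g \<in> carrier G. \<forall>x\<in>D. conjugate g x \<in> E \<longleftrightarrow> x \<in> E} G" (is "subgroup ?C G")
proof (rule subgroupI)
  have "\<one> \<in> ?C" using D by auto
  then show "?C \<noteq> {}" by blast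
  fix g assume g: "g \<in> ?C"
  have "conjugate (inv g) x \<in> E \<longleftrightarrow> x \<in> E" if "x \<in> D" for x
  proof -
    have "conjugate (inv g) x \<in> D" using g that D by simp
    then have "conjugate (inv g) x \<in> E \<longleftrightarrow> conjugate g (conjugate (inv g) x) \<in> E"
      using g by blast
    moreover have "x \<in> carrier G" using that D by blast
    ultimately show ?thesis using g by simp
  qed
  then show "inv g \<in> ?C" using g by simp
  fix h assume h: "h \<in> ?C"
  have "conjugate (g \<otimes> h) x \<in> E \<longleftrightarrow> x \<in> E" if "x \<in> D" for x
  proof -
    have "conjugate h x \<in> D" using h that D by simp
    then have "conjugate g (conjugate h x) \<in> E \<longleftrightarrow> x \<in> E" using g h that by blast
    moreover have "x \<in> carrier G" using that D by blast
    ultimately show ?thesis using g h by (simp add: conjugate_conjugate)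
  qed
  then show "g \<otimes> h \<in> ?C" using g h by simp
qed auto

lemma commutator_eq_one_iff:
  assumes "x \<in> carrier G" "y \<in> carrier G"
  shows "x \<otimes> y \<otimes> inv x \<otimes> inv y = \<one> \<longleftrightarrow> x \<otimes> y = y \<otimes> x"
proof -
  have "x \<otimes> y \<otimes> inv x \<otimes> inv y = (x \<otimes> y) \<otimes> inv (y \<otimes> x)"
    using assms by (simp add: inv_mult_group m_assoc)
  also have "\<dots> = \<one> \<longleftrightarrow> x \<otimes> y = y \<otimes> x"
    using assms by (metis inv_closed inv_equality inv_inv m_closed r_inv)
  finally show ?thesis .
qed

lemma commutator_in_derived:
  "x \<in> H \<Longrightarrow> y \<in> H \<Longrightarrow> x \<otimes> y \<otimes> inv x \<otimes> inv y \<in> derived G H"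
  unfolding derived_def by (intro generate.incl) blast

text \<open>The traces of the chain on the derived subgroup \<open>D\<close> are operator subgroups
  and stabilise; so do its images in the finitely generated abelian quotient by \<open>D\<close>.
  Once both are constant the chain is: elements with the same image differ by an element of the
  trace.\<close>

theorem metabelian_normal_chain_stabilizes:
  fixes N :: "nat \<Rightarrow> 'a set"
  assumes S: "finite S" "S \<subseteq> carrier G" "generate G S = carrier G" and met: "metabelian G"
    and N: "\<And>i. N i \<lhd> G" and inc: "incseq N"
  shows "\<exists>m. \<forall>i\<ge>m. N i = N m"
proof -
  define D where "D = derived G (carrier G)"
  have D_normal: "D \<lhd> G" unfolding D_def by (rule derived_self_is_normal)
  interpret D: normal D G by (rule D_normal)
  define M where "M = G\<lparr>carrier := D\<rparr>"
  have M_simps [simp]: "carrier M = D" "x \<otimes>\<^bsub>M\<^esub> y = x \<otimes> y" "\<one>\<^bsub>M\<^esub> = \<one>" for x y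
    by (simp_all add: M_def)
  have D_comm: "x \<otimes> y = y \<otimes> x" if "x \<in> D" "y \<in> D" for x y
  proof -
    have "x \<otimes> y \<otimes> inv x \<otimes> inv y \<in> derived G D"
      using that by (rule commutator_in_derived)
    also have "derived G D = {\<one>}"
      using met by (simp add: metabelian_def second_derived_def D_def)
    finally show ?thesis using that by (simp add: commutator_eq_one_iff)
  qed
  have "group M" unfolding M_def by (rule subgroup_imp_group[OF D.is_subgroup])
  then interpret M: comm_group M
    by (rule group.group_comm_groupI) (simp add: D_comm)
  have conj_D: "conjugate g x \<in> D \<longleftrightarrow> x \<in> D" if "g \<in> carrier G" "x \<in> carrier G" for g x
    using normal_conjugate_iff[OF D_normal that] .
  define T where "T = conjugate ` S"
  \<comment> \<open>Commutators of the generators. They need not generate \<open>D\<close> as a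
    group, but their conjugates do; hence the span under \<open>T\<close> below.\<close>
  define X where "X = (\<lambda>(g, h). g \<otimes> h \<otimes> inv g \<otimes> inv h) ` (S \<times> S)"
  have T_iso: "t \<in> iso M M" if t: "t \<in> T" for t
  proof -
    obtain g where g: "g \<in> carrier G" "t = conjugate g" using t S unfolding T_def by blast
    show ?thesis
    proof (rule isoI)
      show "t \<in> hom M M"
        by (rule homI) (use g in \<open>simp_all add: conj_D conjugate_mult\<close>)
      show "bij_betw t (carrier M) (carrier M)"
        by (rule bij_betw_byWitness[of _ "conjugate (inv g)"]) (use g in \<open>auto simp: conj_D\<close>)
    qed
  qed
  have T_comm: "t (s x) = s (t x)" if st: "s \<in> T" "t \<in> T" and x: "x \<in> carrier M" for s t x
  proof -
    obtain g h where g: "g \<in> carrier G" "t = conjugate g" and h: "h \<in> carrier G" "s = conjugate h"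
      using st S unfolding T_def by blast
    have xG: "x \<in> carrier G" using x by simp
    \<comment> \<open>The commutator of g and h lies in the abelian group \<open>D\<close> and so
      acts trivially on it. Hence gh and hg act alike, and the conjugations commute on
      \<open>D\<close>.\<close>
    let ?c = "g \<otimes> h \<otimes> inv g \<otimes> inv h"
    have c: "?c \<in> D" unfolding D_def using g h by (intro commutator_in_derived)
    have "conjugate (g \<otimes> h) x = conjugate (?c \<otimes> (h \<otimes> g)) x"
      using g h by (simp add: m_assoc inv_mult_cancel)
    also have "\<dots> = conjugate ?c (conjugate (h \<otimes> g) x)"
      using g h xG by (simp add: conjugate_conjugate)
    also have "\<dots> = conjugate (h \<otimes> g) x"
    proof (rule conjugate_eq_self)
      show "?c \<otimes> conjugate (h \<otimes> g) x = conjugate (h \<otimes> g) x \<otimes> ?c"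
        using c x g h by (intro D_comm) (simp_all add: conj_D)
    qed (use g h xG in auto)
    finally show ?thesis using g h xG by (simp add: conjugate_conjugate)
  qed
  have X: "finite X" "X \<subseteq> D"
    using S by (auto simp: X_def D_def intro!: commutator_in_derived)
  define E where "E = operator_span M T X"
  have E_op: "operator_subgroup M T E"
    unfolding E_def using T_iso X by (intro M.operator_subgroup_span) (auto simp: iso_def)
  have E_sub_D: "E \<subseteq> D"
    using E_op subgroup.subset[of E M] by (simp add: operator_subgroup_def)
  have E_subgroup: "subgroup E G"
    using incl_subgroup[OF D.is_subgroup] E_op by (simp add: operator_subgroup_def M_def)
  have "E \<lhd> G"
  proof (rule normal_invI[OF E_subgroup])
    \<comment> \<open>Invariance of \<open>E\<close> is known only for conjugation by elements of
      \<open>S\<close>; the elements with this property form a subgroup, hence are all of the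
      group.\<close>
    let ?C = "{g \<in> carrier G. \<forall>x\<in>D. conjugate g x \<in> E \<longleftrightarrow> x \<in> E}"
    have C_subgroup: "subgroup ?C G"
      using D.subset by (intro normalizer_subgroup) (auto simp: conj_D)
    have "S \<subseteq> ?C"
    proof
      fix g assume "g \<in> S"
      then have "conjugate g \<in> T" "g \<in> carrier G" using S by (auto simp: T_def)
      moreover have "\<forall>x\<in>D. conjugate g x \<in> E \<longleftrightarrow> x \<in> E" if "conjugate g \<in> T"
        using E_op that unfolding operator_subgroup_def M_simps by blast
      ultimately show "g \<in> ?C" by simp
    qed
    then have C: "carrier G \<subseteq> ?C"
      using generate_subgroup_incl[OF _ C_subgroup, of S] unfolding S(3) by blast
    fix g x assume "g \<in> carrier G" "x \<in> E"
    then have "conjugate g x \<in> E" using C E_sub_D by blast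
    then show "g \<otimes> x \<otimes> inv g \<in> E" by (simp add: conjugate_def)
  qed
  then interpret E: normal E G .
  \<comment> \<open>Modulo \<open>E\<close> the generators commute, so the quotient is abelian and
    \<open>D\<close> becomes trivial in it.\<close>
  have "D \<subseteq> E"
  proof -
    let ?q = "\<lambda>x. E #> x"
    interpret Q: group "G Mod E" by (rule E.factorgroup_is_group)
    interpret q: group_hom G "G Mod E" ?q
      by (rule group_hom_epi[OF _ _ FactGroup_natural_epi]) unfold_locales
    have S_comm: "?q g \<otimes>\<^bsub>G Mod E\<^esub> ?q h = ?q h \<otimes>\<^bsub>G Mod E\<^esub> ?q g" if "g \<in> S" "h \<in> S" for g h
    proof -
      have gh: "g \<in> carrier G" "h \<in> carrier G" using that S by auto
      have "g \<otimes> h \<otimes> inv g \<otimes> inv h \<in> X" using that by (force simp: X_def)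
      then have "g \<otimes> h \<otimes> inv g \<otimes> inv h \<in> E"
        using operator_span_incl[of X M T] by (auto simp: E_def)
      then have "?q (g \<otimes> h \<otimes> inv g \<otimes> inv h) = \<one>\<^bsub>G Mod E\<^esub>"
        using E.rcos_const[OF is_group] by simp
      then have "?q g \<otimes>\<^bsub>G Mod E\<^esub> ?q h \<otimes>\<^bsub>G Mod E\<^esub> inv\<^bsub>G Mod E\<^esub> ?q g \<otimes>\<^bsub>G Mod E\<^esub> inv\<^bsub>G Mod E\<^esub> ?q h
          = \<one>\<^bsub>G Mod E\<^esub>"
        using gh by (simp only: q.hom_mult q.hom_inv m_closed inv_closed)
      then show ?thesis
        using Q.commutator_eq_one_iff[of "?q g" "?q h"] gh q.hom_closed by blast
    qed
    have gen: "generate (G Mod E) (?q ` S) = carrier (G Mod E)"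
      using q.generate_img[OF S(2)] S(3) by (simp add: carrier_FactGroup)
    have qS: "?q ` S \<subseteq> carrier (G Mod E)" using S(2) q.hom_closed by blast
    have "x \<otimes>\<^bsub>G Mod E\<^esub> y = y \<otimes>\<^bsub>G Mod E\<^esub> x"
      if "x \<in> carrier (G Mod E)" "y \<in> carrier (G Mod E)" for x y
    proof (rule Q.generate_commute[OF qS _ that[folded gen]])
      show "u \<otimes>\<^bsub>G Mod E\<^esub> v = v \<otimes>\<^bsub>G Mod E\<^esub> u" if "u \<in> ?q ` S" "v \<in> ?q ` S" for u v
        using that S_comm by blast
    qed
    then interpret Q: comm_group "G Mod E" by (intro Q.group_comm_groupI)
    have "derived (G Mod E) (?q ` carrier G) = {\<one>\<^bsub>G Mod E\<^esub>}"
      by (intro Q.derived_eq_singleton) auto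
    then have "?q ` D = {\<one>\<^bsub>G Mod E\<^esub>}"
      using q.derived_img[of "carrier G"] by (simp add: D_def)
    then have "D \<subseteq> kernel G (G Mod E) ?q"
      using D.subset by (auto simp: kernel_def)
    then show ?thesis using kernel_FactGroup_natural[OF \<open>E \<lhd> G\<close>] by simp
  qed
  have "operator_noetherian M T E"
    unfolding E_def using S T_iso T_comm X
    by (intro M.noetherian_operator_span) (auto simp: T_def)
  then have noeth_D: "operator_noetherian M T D"
    using \<open>D \<subseteq> E\<close> by (rule operator_noetherian_subset)
  have "operator_subgroup M T (N i \<inter> D)" for i
    unfolding operator_subgroup_def
  proof (intro conjI ballI)
    have "subgroup (N i \<inter> D) G"
      using subgroups_Inter_pair[OF normal_imp_subgroup[OF N] D.is_subgroup] .
    then show "subgroup (N i \<inter> D) M"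
      unfolding M_def by (rule subgroup_incl[OF _ D.is_subgroup]) auto
    show "t x \<in> N i \<inter> D \<longleftrightarrow> x \<in> N i \<inter> D" if "t \<in> T" "x \<in> carrier M" for t x
      using that S normal_conjugate_iff[OF N] by (auto simp: T_def conj_D)
  qed
  moreover have "incseq (\<lambda>i. N i \<inter> D)" using inc by (auto simp: incseq_def)
  ultimately obtain m1 where m1: "\<And>i. i \<ge> m1 \<Longrightarrow> N i \<inter> D = N m1 \<inter> D"
    using operator_noetherianD[OF noeth_D, of "\<lambda>i. N i \<inter> D"] by auto
  let ?p = "\<lambda>x. D #> x"
  interpret P: comm_group "G Mod D"
    unfolding D_def by (rule derived_quot_is_comm_group)
  interpret p: group_hom G "G Mod D" ?p
    by (rule group_hom_epi[OF _ _ FactGroup_natural_epi]) unfold_locales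
  have gen: "generate (G Mod D) (?p ` S) = carrier (G Mod D)"
    using p.generate_img[OF S(2)] S(3) by (simp add: carrier_FactGroup)
  have "operator_noetherian (G Mod D) {} (carrier (G Mod D))"
    using P.noetherian_generate[of "?p ` S"] S p.hom_closed unfolding gen by blast
  moreover have "operator_subgroup (G Mod D) {} (?p ` N i)" for i
    using p.subgroup_img_is_subgroup[OF normal_imp_subgroup[OF N]]
    by (simp add: operator_subgroup_def)
  moreover have "incseq (\<lambda>i. ?p ` N i)" using inc by (auto simp: incseq_def)
  moreover have "?p ` N i \<subseteq> carrier (G Mod D)" for i
    using normal_imp_subgroup[OF N] subgroup.subset p.hom_closed by blast
  ultimately obtain m2 where m2: "\<And>i. i \<ge> m2 \<Longrightarrow> ?p ` N i = ?p ` N m2"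
    using operator_noetherianD[of "G Mod D" "{}" _ "\<lambda>i. ?p ` N i"] by blast
  let ?m = "max m1 m2"
  have "N i = N ?m" if i: "i \<ge> ?m" for i
  proof
    interpret Ni: subgroup "N i" G by (rule normal_imp_subgroup[OF N])
    interpret Nm: subgroup "N ?m" G by (rule normal_imp_subgroup[OF N])
    show sub: "N ?m \<subseteq> N i" using inc i by (rule incseqD)
    show "N i \<subseteq> N ?m"
    proof
      fix y assume y: "y \<in> N i"
      have ge: "i \<ge> m1" "?m \<ge> m1" "i \<ge> m2" "?m \<ge> m2" using i by auto
      have eq: "?p ` N i = ?p ` N ?m" "N i \<inter> D = N ?m \<inter> D"
        unfolding m1[OF ge(1)] m1[OF ge(2)] m2[OF ge(3)] m2[OF ge(4)] by (rule HOL.refl)+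
      have "D #> y \<in> ?p ` N ?m" unfolding eq(1)[symmetric] using y by (rule imageI)
      then obtain n where n: "n \<in> N ?m" "D #> y = D #> n" by (rule imageE)
      have yG: "y \<in> carrier G" and nG: "n \<in> carrier G" using y n by auto
      have "y \<in> D #> n" using n rcos_self[OF yG D.is_subgroup] by simp
      then obtain d where d: "d \<in> D" "y = d \<otimes> n" by (auto simp: r_coset_def)
      then have "d = y \<otimes> inv n" using nG by (simp add: m_assoc)
      then have "d \<in> N i" using y n sub by blast
      then have "d \<in> N ?m \<inter> D" unfolding eq(2)[symmetric] using d by simp
      then show "y \<in> N ?m" using d n by simp
    qed
  qed
  then show ?thesis by blast
qed

corollary metabelian_normal_subgroup_finite_closure:
  assumes S: "finite S" "S \<subseteq> carrier G" "generate G S = carrier G" and met: "metabelian G"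
    and K: "K \<lhd> G"
  shows "\<exists>Y. finite Y \<and> Y \<subseteq> K \<and> normal_closure G Y = K"
proof (rule ccontr)
  assume "\<not> ?thesis"
  then have no: "normal_closure G Y \<noteq> K" if "finite Y" "Y \<subseteq> K" for Y
    using that by blast
  \<comment> \<open>Each stage adds an element of \<open>K\<close> outside the normal closure
    reached so far. Under the assumption \<open>no\<close> such an element always exists, and the
    closures form a chain that never becomes stationary.\<close>
  define f where "f = rec_nat {} (\<lambda>_ Y. insert (SOME y. y \<in> K - normal_closure G Y) Y)"
  have f_Suc: "f (Suc n) = insert (SOME y. y \<in> K - normal_closure G (f n)) (f n)" for n
    by (simp add: f_def)
  have some: "(SOME y. y \<in> K - normal_closure G Y) \<in> K - normal_closure G Y"
    if "finite Y" "Y \<subseteq> K" for Y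
  proof -
    have "\<exists>y. y \<in> K - normal_closure G Y"
      using normal_closure_least[OF K that(2)] no[OF that] by blast
    then show ?thesis by (rule someI_ex)
  qed
  have f: "finite (f n) \<and> f n \<subseteq> K" for n
  proof (induction n)
    case (Suc n)
    then show ?case using some[of "f n"] by (simp add: f_Suc)
  qed (simp add: f_def)
  have KG: "K \<subseteq> carrier G" using K normal_imp_subgroup subgroup.subset by blast
  have normal: "normal_closure G (f n) \<lhd> G" for n
    using f KG by (intro normal_closure_normal) blast
  have "incseq (\<lambda>n. normal_closure G (f n))"
  proof (rule incseq_SucI)
    show "normal_closure G (f n) \<subseteq> normal_closure G (f (Suc n))" for n
      using normal_closure_incl[of "f (Suc n)"]
      by (intro normal_closure_least[OF normal]) (auto simp: f_Suc)
  qed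
  then obtain m where m: "\<forall>i\<ge>m. normal_closure G (f i) = normal_closure G (f m)"
    using metabelian_normal_chain_stabilizes[of S "\<lambda>n. normal_closure G (f n)"] S met normal by blast
  have "(SOME y. y \<in> K - normal_closure G (f m)) \<in> normal_closure G (f (Suc m))"
    using normal_closure_incl[of "f (Suc m)"] by (auto simp: f_Suc)
  also have "normal_closure G (f (Suc m)) = normal_closure G (f m)"
    using m le_SucI by blast
  finally show False using some[of "f m"] f by blast
qed

end

text \<open>The kernel of the quotient map is the normal closure of a finite set \<open>Y\<close>.
  Adding preimages of \<open>Y\<close> in the free group to the relators of \<open>G\<close>
  presents the quotient.\<close>

theorem metabelian_finitely_presented_quotient:
  assumes G: "group G" "metabelian G" "finitely_presented G" and M: "group M" "maps_onto G M"
  shows "finitely_presented M"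
proof -
  obtain q where q: "q \<in> epi G M" using M by (auto simp: maps_onto_def)
  obtain n :: nat and R p where R: "finite R" "R \<subseteq> carrier (free_group {..<n})"
    and p: "p \<in> epi (free_group {..<n}) G"
    and ker_p: "kernel (free_group {..<n}) G p = normal_closure (free_group {..<n}) R"
    using G(3) unfolding finitely_presented_iff[OF G(1)] by blast
  let ?F = "free_group {..<n}"
  interpret p: group_hom ?F G p using G p by (simp add: group_hom_epi)
  interpret q: group_hom G M q using G M q by (simp add: group_hom_epi)
  have pq: "q \<circ> p \<in> epi ?F M" using p q by (rule epi_compose)
  interpret pq: group_hom ?F M "q \<circ> p" using M pq by (simp add: group_hom_epi)
  have p_surj: "p ` carrier ?F = carrier G" using p by (simp add: epi_def)
  have gens: "free_gen {..<n} ` {..<n} \<subseteq> carrier ?F" by auto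
  then have "generate G (p ` free_gen {..<n} ` {..<n}) = carrier G"
    using p.generate_img[OF gens] p_surj by (simp add: generate_free_group)
  moreover have "p ` free_gen {..<n} ` {..<n} \<subseteq> carrier G" by auto
  moreover have "finite (p ` free_gen {..<n} ` {..<n})" by simp
  ultimately have "\<exists>Y. finite Y \<and> Y \<subseteq> kernel G M q \<and> normal_closure G Y = kernel G M q"
    using p.H.metabelian_normal_subgroup_finite_closure G(2) q.normal_kernel by metis
  then obtain Y where Y: "finite Y" "Y \<subseteq> kernel G M q" "normal_closure G Y = kernel G M q"
    by blast
  have "Y \<subseteq> p ` carrier ?F" using Y p_surj by (auto simp: kernel_def)
  then obtain Z where Z: "Z \<subseteq> carrier ?F" "finite Z" "Y = p ` Z"
    using finite_subset_image[OF Y(1)] by blast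
  let ?L = "normal_closure ?F (R \<union> Z)"
  have L: "?L \<lhd> ?F" using R Z by (intro p.G.normal_closure_normal) auto
  interpret L: normal ?L ?F by (rule L)
  have "kernel ?F M (q \<circ> p) = ?L"
  proof
    have "R \<subseteq> kernel ?F G p" using ker_p p.G.normal_closure_incl by simp
    then have "R \<subseteq> kernel ?F M (q \<circ> p)" by (auto simp: kernel_def)
    moreover have "Z \<subseteq> kernel ?F M (q \<circ> p)" using Z Y by (auto simp: kernel_def)
    ultimately show "?L \<subseteq> kernel ?F M (q \<circ> p)"
      by (intro p.G.normal_closure_least[OF pq.normal_kernel]) simp
    have pL: "kernel G M q \<subseteq> p ` ?L"
    proof -
      have "Y \<subseteq> p ` ?L" using Z p.G.normal_closure_incl[of "R \<union> Z"] by blast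
      then show ?thesis
        using p.H.normal_closure_least[OF L.surj_hom_normal_subgroup[OF p.group_hom_axioms p_surj], of Y] Y(3)
        by simp
    qed
    show "kernel ?F M (q \<circ> p) \<subseteq> ?L"
    proof
      fix x assume x: "x \<in> kernel ?F M (q \<circ> p)"
      then have xF: "x \<in> carrier ?F" and "p x \<in> kernel G M q" by (auto simp: kernel_def)
      then obtain l where l: "l \<in> ?L" "p x = p l" using pL by blast
      then have "x \<otimes>\<^bsub>?F\<^esub> inv\<^bsub>?F\<^esub> l \<in> kernel ?F G p"
        using xF by (simp add: kernel_def)
      also have "kernel ?F G p \<subseteq> ?L"
        unfolding ker_p using p.G.normal_closure_incl[of "R \<union> Z"]
        by (intro p.G.normal_closure_least[OF L]) simp
      finally have "x \<otimes>\<^bsub>?F\<^esub> inv\<^bsub>?F\<^esub> l \<otimes>\<^bsub>?F\<^esub> l \<in> ?L" using l by blast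
      then show "x \<in> ?L" using xF l by (simp add: p.G.m_assoc)
    qed
  qed
  then show ?thesis
    unfolding finitely_presented_iff[OF M(1)] using R Z pq
    by (intro exI[of _ n] exI[of _ "R \<union> Z"] exI[of _ "q \<circ> p"]) auto
qed

section \<open>Extensions of locally finite abelian groups by infinite cyclic groups\<close>

text \<open>Permutations of the whole type make the operations plain \<open>\<circ>\<close> and
  \<open>id\<close>; accordingly \<open>translation\<close> is extended by the identity outside the
  carrier.\<close>

definition permutation_group :: "('a \<Rightarrow> 'a) monoid" where
  "permutation_group = \<lparr>carrier = {f. bij f}, monoid.mult = (\<circ>), one = id\<rparr>"

lemma permutation_group_simps [simp]:
  "f \<in> carrier permutation_group \<longleftrightarrow> bij f"
  "f \<otimes>\<^bsub>permutation_group\<^esub> g = f \<circ> g"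
  "\<one>\<^bsub>permutation_group\<^esub> = id"
  by (simp_all add: permutation_group_def)

lemma group_permutation_group [simp]: "group permutation_group"
proof (rule groupI)
  fix f :: "'a \<Rightarrow> 'a" assume "f \<in> carrier permutation_group"
  then show "\<exists>g\<in>carrier permutation_group. g \<otimes>\<^bsub>permutation_group\<^esub> f = \<one>\<^bsub>permutation_group\<^esub>"
    by (intro bexI[of _ "inv_into UNIV f"]) (auto simp: bij_imp_bij_inv bij_is_inj)
qed (auto simp: bij_comp comp_assoc)

definition translation :: "('a, 'm) monoid_scheme \<Rightarrow> 'a \<Rightarrow> 'a \<Rightarrow> 'a" where
  "translation G a x = (if x \<in> carrier G then a \<otimes>\<^bsub>G\<^esub> x else x)"

lemma (in group) translation_hom: "translation G \<in> hom G permutation_group"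
proof (rule homI)
  have comp: "translation G (a \<otimes> b) = translation G a \<circ> translation G b"
    if "a \<in> carrier G" "b \<in> carrier G" for a b
    using that by (auto simp: translation_def m_assoc)
  have one: "translation G \<one> = id" by (auto simp: translation_def)
  show "translation G a \<in> carrier permutation_group" if a: "a \<in> carrier G" for a
    using comp[of a "inv a"] comp[of "inv a" a] a one
    by (simp add: o_bij[of "translation G (inv a)"])
  show "translation G (a \<otimes> b) = translation G a \<otimes>\<^bsub>permutation_group\<^esub> translation G b"
    if "a \<in> carrier G" "b \<in> carrier G" for a b
    using comp[OF that] by simp
qed

text \<open>The permutation \<open>\<tau>\<close> is \<open>\<theta>\<close> composed with the exchange of the cosets \<open>S\<close> and \<open>u S\<close>, for
  an element \<open>u\<close> outside finitely many forbidden cosets.\<close>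

lemma (in comm_group) twisted_permutation:
  assumes inf: "infinite (carrier G)" and \<theta>: "\<theta> \<in> iso G G"
    and S: "subgroup S G" "finite S"
    and b: "b \<in> carrier G" "b \<notin> S" and d: "d \<in> carrier G" "d \<notin> S" and bd: "b \<otimes> d \<notin> S"
  obtains \<tau> where "\<tau> \<in> carrier permutation_group"
    "\<And>s. s \<in> S \<Longrightarrow>
      group.conjugate permutation_group \<tau> (translation G s) = translation G (\<theta> s)"
    "group.conjugate permutation_group \<tau> (translation G b) \<circ> translation G (\<theta> d) \<noteq>
     translation G (\<theta> d) \<circ> group.conjugate permutation_group \<tau> (translation G b)"
proof -
  interpret S: subgroup S G by (rule S)
  interpret P: group "permutation_group :: ('a \<Rightarrow> 'a) monoid" by simp
  let ?L = "translation G"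
  \<comment> \<open>The forbidden sets ensure, in this order, that u S differs from S, that d and b
    d lie outside u S, and that b u lies outside S. By the last three, the exchange of cosets fixes
    d, b d and b u.\<close>
  have "finite (S \<union> (\<lambda>s. d \<otimes> s) ` S \<union> (\<lambda>s. b \<otimes> d \<otimes> s) ` S \<union> (\<lambda>s. inv b \<otimes> s) ` S)"
    using S by simp
  then obtain u where u: "u \<in> carrier G"
    "u \<notin> S \<union> (\<lambda>s. d \<otimes> s) ` S \<union> (\<lambda>s. b \<otimes> d \<otimes> s) ` S \<union> (\<lambda>s. inv b \<otimes> s) ` S"
    using inf by (meson finite_subset subsetI)
  have not_coset: "inv u \<otimes> x \<notin> S" if "x \<in> carrier G" "u \<notin> (\<lambda>s. x \<otimes> s) ` S" for x
  proof
    assume "inv u \<otimes> x \<in> S"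
    then have "inv (inv u \<otimes> x) \<in> S" by simp
    moreover have "u = x \<otimes> inv (inv u \<otimes> x)"
      using u that by (simp add: inv_mult_group inv_mult_cancel)
    ultimately show False using that by blast
  qed
  define \<delta> where "\<delta> x = (if x \<in> S then u \<otimes> x
    else if x \<in> carrier G \<and> inv u \<otimes> x \<in> S then inv u \<otimes> x else x)" for x
  have u_mult: "u \<otimes> x \<notin> S" if "x \<in> S" for x
  proof
    assume "u \<otimes> x \<in> S"
    then have "u \<otimes> x \<otimes> inv x \<in> S" using that by blast
    then show False using u that by (simp add: m_assoc)
  qed
  have \<delta>\<delta>: "\<delta> (\<delta> x) = x" for x
    using u u_mult by (auto simp: \<delta>_def inv_mult_cancel)
  have "bij \<delta>" by (rule o_bij[of \<delta>]) (auto simp: \<delta>\<delta>)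
  \<comment> \<open>The exchange is multiplication by u or its inverse on cosets of
    \<open>S\<close>, and the group is abelian; so it commutes with translations by
    \<open>S\<close>, and \<open>\<tau>\<close> conjugates these exactly as \<open>\<theta>\<close>
    does.\<close>
  have \<delta>L: "\<delta> (?L s x) = ?L s (\<delta> x)" if s: "s \<in> S" for s x
  proof (cases "x \<in> carrier G")
    case True
    have mem: "s \<otimes> y \<in> S \<longleftrightarrow> y \<in> S" if "y \<in> carrier G" for y
    proof
      assume "s \<otimes> y \<in> S"
      then have "inv s \<otimes> (s \<otimes> y) \<in> S" using s by blast
      then show "y \<in> S" using s that by (simp add: inv_mult_cancel)
    qed (use s in blast)
    have comm: "z \<otimes> (s \<otimes> x) = s \<otimes> (z \<otimes> x)" if "z \<in> carrier G" for z
      using s True that by (simp add: m_lcomm)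
    show ?thesis
      using True s u mem[of x] mem[of "inv u \<otimes> x"] comm[of u] comm[of "inv u"]
      by (auto simp: translation_def \<delta>_def)
  next
    case False
    then show ?thesis using S.subset by (auto simp: translation_def \<delta>_def)
  qed
  define \<theta>' where "\<theta>' x = (if x \<in> carrier G then \<theta> x else x)" for x
  have \<theta>_bij: "bij_betw \<theta> (carrier G) (carrier G)" and \<theta>_hom: "\<theta> \<in> hom G G"
    using \<theta> by (auto simp: iso_def)
  have "bij_betw \<theta>' (carrier G \<union> - carrier G) (carrier G \<union> - carrier G)"
  proof (rule bij_betw_combine)
    show "bij_betw \<theta>' (carrier G) (carrier G)"
      using \<theta>_bij by (simp add: \<theta>'_def cong: bij_betw_cong)
    show "bij_betw \<theta>' (- carrier G) (- carrier G)"
      using bij_betw_id by (rule bij_betw_cong[THEN iffD1, rotated]) (simp add: \<theta>'_def)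
  qed auto
  then have "bij \<theta>'" by simp
  have \<theta>L: "\<theta>' (?L a x) = ?L (\<theta> a) (\<theta>' x)" if "a \<in> carrier G" for a x
    using that hom_mult[OF \<theta>_hom] hom_in_carrier[OF \<theta>_hom] by (auto simp: \<theta>'_def translation_def)
  define \<tau> where "\<tau> = \<theta>' \<circ> \<delta>"
  have "bij \<tau>" unfolding \<tau>_def using \<open>bij \<delta>\<close> \<open>bij \<theta>'\<close> by (rule bij_comp)
  then have \<tau>: "\<tau> \<in> carrier permutation_group" by simp
  have L: "?L a \<in> carrier permutation_group" if "a \<in> carrier G" for a
    using translation_hom that by (rule hom_in_carrier)
  have conj_apply: "P.conjugate \<tau> f (\<tau> x) = \<tau> (f x)" for f x
  proof -
    have "(m_inv permutation_group \<tau> \<circ> \<tau>) x = x"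
      using P.l_inv[OF \<tau>] by simp
    then show ?thesis by (simp add: P.conjugate_def)
  qed
  show thesis
  proof (rule that[OF \<tau>])
    fix s assume s: "s \<in> S"
    have "P.conjugate \<tau> (?L s) (\<tau> x) = ?L (\<theta> s) (\<tau> x)" for x
      unfolding conj_apply using s by (simp add: \<tau>_def \<delta>L \<theta>L)
    then show "P.conjugate \<tau> (?L s) = ?L (\<theta> s)"
      using bij_is_surj[OF \<open>bij \<tau>\<close>] by (metis ext surjD)
  next
    have \<delta>1: "\<delta> u = \<one>" "\<delta> d = d" "\<delta> (b \<otimes> d) = b \<otimes> d" "\<delta> (b \<otimes> u) = b \<otimes> u"
    proof -
      show "\<delta> u = \<one>" using u by (simp add: \<delta>_def)
      show "\<delta> d = d" using u d not_coset[of d] by (auto simp: \<delta>_def)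
      show "\<delta> (b \<otimes> d) = b \<otimes> d" using u b d bd not_coset[of "b \<otimes> d"] by (auto simp: \<delta>_def)
      have "b \<otimes> u \<notin> S"
      proof
        assume "b \<otimes> u \<in> S"
        moreover have "u = inv b \<otimes> (b \<otimes> u)" using b u by (simp add: inv_mult_cancel)
        ultimately show False using u by blast
      qed
      moreover have "inv u \<otimes> (b \<otimes> u) = b"
        using b u by (simp add: m_comm[of b u] inv_mult_cancel)
      ultimately show "\<delta> (b \<otimes> u) = b \<otimes> u" using b by (simp add: \<delta>_def)
    qed
    have \<theta>'_eq: "\<theta>' x = \<tau> (\<delta> x)" for x by (simp add: \<tau>_def \<delta>\<delta>)
    have \<theta>1: "\<theta>' \<one> = \<tau> u" using \<delta>\<delta>[of u] \<delta>1 by (simp add: \<theta>'_eq)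
    \<comment> \<open>Both products are compared at the point \<open>\<theta>' \<one>\<close>, which
      equals \<open>\<tau> u\<close>. There the results are the images of b d and of d b u, which
      differ because u is not the identity.\<close>
    have l: "(P.conjugate \<tau> (?L b) \<circ> ?L (\<theta> d)) (\<theta>' \<one>) = \<theta>' (b \<otimes> d)"
    proof -
      have "?L (\<theta> d) (\<theta>' \<one>) = \<theta>' (?L d \<one>)" using d by (simp add: \<theta>L)
      also have "\<dots> = \<tau> d" using d \<delta>1 by (simp add: \<theta>'_eq translation_def)
      finally have "(P.conjugate \<tau> (?L b) \<circ> ?L (\<theta> d)) (\<theta>' \<one>) = \<tau> (?L b d)"
        by (simp add: conj_apply)
      also have "\<dots> = \<theta>' (b \<otimes> d)" using d \<delta>1 by (simp add: \<theta>'_eq translation_def)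
      finally show ?thesis .
    qed
    have r: "(?L (\<theta> d) \<circ> P.conjugate \<tau> (?L b)) (\<theta>' \<one>) = \<theta>' (d \<otimes> (b \<otimes> u))"
    proof -
      have "(?L (\<theta> d) \<circ> P.conjugate \<tau> (?L b)) (\<theta>' \<one>) = ?L (\<theta> d) (\<tau> (?L b u))"
        by (simp add: \<theta>1 conj_apply)
      also have "\<tau> (?L b u) = \<theta>' (b \<otimes> u)" using u \<delta>1 by (simp add: \<theta>'_eq translation_def)
      also have "?L (\<theta> d) (\<theta>' (b \<otimes> u)) = \<theta>' (?L d (b \<otimes> u))" using d by (simp add: \<theta>L)
      also have "?L d (b \<otimes> u) = d \<otimes> (b \<otimes> u)" using b u by (simp add: translation_def)
      finally show ?thesis .
    qed
    have "b \<otimes> d \<noteq> d \<otimes> (b \<otimes> u)"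
    proof
      assume "b \<otimes> d = d \<otimes> (b \<otimes> u)"
      then have "b \<otimes> d = b \<otimes> d \<otimes> u" using b d u by (simp add: m_ac)
      then have "u = \<one>" using b d u by simp
      then show False using u by simp
    qed
    then have "\<theta>' (b \<otimes> d) \<noteq> \<theta>' (d \<otimes> (b \<otimes> u))"
      using bij_is_inj[OF \<open>bij \<theta>'\<close>] by (simp add: inj_eq)
    then show "P.conjugate \<tau> (?L b) \<circ> ?L (\<theta> d) \<noteq> ?L (\<theta> d) \<circ> P.conjugate \<tau> (?L b)"
      using l r by metis
  qed
qed

lemma (in group_hom) hom_conjugate:
  "g \<in> carrier G \<Longrightarrow> x \<in> carrier G \<Longrightarrow> h (G.conjugate g x) = H.conjugate (h g) (h x)"
  by (simp add: G.conjugate_def H.conjugate_def)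

lemma (in group) conjugate_hom: "g \<in> carrier G \<Longrightarrow> group_hom G G (conjugate g)"
  by (auto simp: group_hom_def group_hom_axioms_def conjugate_mult intro!: homI)

lemma (in group) conjugate_mult_self:
  "g \<in> carrier G \<Longrightarrow> x \<in> carrier G \<Longrightarrow> conjugate g x \<otimes> g = g \<otimes> x"
  by (simp add: conjugate_def m_assoc)

section \<open>Normal forms and layers in an extension by an infinite cyclic group\<close>

text \<open>A projection to the integers, instead of an abstract quotient, provides the exponent
  needed for the normal form \<open>base_part x \<otimes> t [^] \<pi> x\<close>.\<close>

locale infinite_cyclic_extension = group +
  fixes \<pi> :: "'a \<Rightarrow> int" and t :: 'a
  assumes pi_hom: "\<pi> \<in> hom G integer_group" and t_closed [simp]: "t \<in> carrier G"
    and pi_t [simp]: "\<pi> t = 1"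
begin

sublocale pi: group_hom G integer_group \<pi>
  by (simp add: group_hom_def group_hom_axioms_def pi_hom)

lemma pi_mult [simp]: "x \<in> carrier G \<Longrightarrow> y \<in> carrier G \<Longrightarrow> \<pi> (x \<otimes> y) = \<pi> x + \<pi> y"
  using pi.hom_mult by simp

lemma pi_one [simp]: "\<pi> \<one> = 0"
  using pi.hom_one by simp

lemma pi_inv [simp]: "x \<in> carrier G \<Longrightarrow> \<pi> (inv x) = - \<pi> x"
  using pi.hom_inv by simp

lemma pi_t_pow [simp]: "\<pi> (t [^] (j::int)) = j"
  using pi.hom_int_pow[of t j] by simp

definition base_group :: "'a set" where "base_group = kernel G integer_group \<pi>"

lemma base_group_iff: "x \<in> base_group \<longleftrightarrow> x \<in> carrier G \<and> \<pi> x = 0"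
  by (simp add: base_group_def kernel_def)

lemma base_group_normal: "base_group \<lhd> G"
  unfolding base_group_def by (rule pi.normal_kernel)

lemma conjugate_base [simp]: "g \<in> carrier G \<Longrightarrow> x \<in> base_group \<Longrightarrow> conjugate g x \<in> base_group"
  by (simp add: base_group_iff conjugate_def)

definition base_part :: "'a \<Rightarrow> 'a" where "base_part x = x \<otimes> t [^] (- \<pi> x)"

lemma base_part_closed [simp]: "x \<in> carrier G \<Longrightarrow> base_part x \<in> carrier G"
  by (simp add: base_part_def)

lemma base_part_mem: "x \<in> carrier G \<Longrightarrow> base_part x \<in> base_group"
  by (simp add: base_group_iff base_part_def)

lemma base_part_decomp: "x \<in> carrier G \<Longrightarrow> x = base_part x \<otimes> t [^] \<pi> x"
  by (simp add: base_part_def m_assoc int_pow_neg)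

lemma base_part_base [simp]: "x \<in> base_group \<Longrightarrow> base_part x = x"
  by (simp add: base_group_iff base_part_def)

lemma base_part_t [simp]: "base_part t = \<one>"
  by (simp add: base_part_def int_pow_neg)

lemma base_part_mult:
  assumes "x \<in> carrier G" "y \<in> carrier G"
  shows "base_part (x \<otimes> y) = base_part x \<otimes> conjugate (t [^] \<pi> x) (base_part y)"
proof -
  have "t [^] (- \<pi> x - \<pi> y) = t [^] (- \<pi> y) \<otimes> t [^] (- \<pi> x)"
    using int_pow_mult[of t "- \<pi> y" "- \<pi> x"] by (simp add: add.commute)
  then show ?thesis
    using assms by (simp add: base_part_def conjugate_def m_assoc int_pow_neg inv_mult_cancel)
qed

lemma base_part_inv:
  assumes "x \<in> carrier G"
  shows "base_part (inv x) = conjugate (t [^] (- \<pi> x)) (inv (base_part x))"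
  using assms by (simp add: base_part_def conjugate_def m_assoc int_pow_neg inv_mult_group inv_mult_cancel)

text \<open>The part of the base group that is visible when exponents of \<open>t\<close> are
  bounded by \<open>K\<close>. The range is symmetric because words also contain inverses;
  conjugation by a power of \<open>t\<close> widens it by the absolute value of the
  exponent.\<close>

definition layer_group :: "'a set \<Rightarrow> nat \<Rightarrow> 'a set" where
  "layer_group A K = generate G {conjugate (t [^] j) a | j a. a \<in> A \<and> \<bar>j\<bar> \<le> int K}"

lemma layer_gens_closed:
  "A \<subseteq> base_group \<Longrightarrow> {conjugate (t [^] j) a | j a. a \<in> A \<and> \<bar>j::int\<bar> \<le> int K} \<subseteq> base_group"
  by auto

lemma base_group_subset: "base_group \<subseteq> carrier G"
  by (auto simp: base_group_iff)

lemma layer_group_subgroup: "A \<subseteq> base_group \<Longrightarrow> subgroup (layer_group A K) G"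
  unfolding layer_group_def
  by (rule generate_is_subgroup) (use layer_gens_closed base_group_subset in blast)

lemma layer_group_subset: "A \<subseteq> base_group \<Longrightarrow> layer_group A K \<subseteq> base_group"
  unfolding layer_group_def
  by (rule generate_subgroup_incl[OF layer_gens_closed normal_imp_subgroup[OF base_group_normal]])

lemma layer_group_mono: "K \<le> K' \<Longrightarrow> layer_group A K \<subseteq> layer_group A K'"
  unfolding layer_group_def by (rule mono_generate) (use order_trans zle_int in blast)

lemma layer_group_incl:
  assumes "A \<subseteq> base_group"
  shows "A \<subseteq> layer_group A K"
proof
  fix a assume a: "a \<in> A"
  then have "a = conjugate (t [^] (0::int)) a" using assms base_group_subset by auto
  then show "a \<in> layer_group A K" unfolding layer_group_def
    using a by (intro generate.incl CollectI exI[of _ "0::int"] exI[of _ a]) auto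
qed

lemma conjugate_layer_group:
  assumes A: "A \<subseteq> base_group" and x: "x \<in> layer_group A K" and le: "int K + \<bar>j\<bar> \<le> int K'"
  shows "conjugate (t [^] j) x \<in> layer_group A K'"
proof -
  let ?X = "{conjugate (t [^] j) a | j a. a \<in> A \<and> \<bar>j\<bar> \<le> int K}"
  let ?Y = "{conjugate (t [^] j) a | j a. a \<in> A \<and> \<bar>j\<bar> \<le> int K'}"
  interpret c: group_hom G G "conjugate (t [^] j)" by (rule conjugate_hom) simp
  have X: "?X \<subseteq> carrier G" using layer_gens_closed[OF A] base_group_subset by blast
  have "conjugate (t [^] j) ` ?X \<subseteq> ?Y"
  proof
    fix y assume "y \<in> conjugate (t [^] j) ` ?X"
    then obtain i a where a: "a \<in> A" "\<bar>i\<bar> \<le> int K" "y = conjugate (t [^] j) (conjugate (t [^] i) a)"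
      by auto
    moreover have "a \<in> carrier G" using a A base_group_subset by blast
    ultimately have "y = conjugate (t [^] (j + i)) a" by (simp add: conjugate_conjugate int_pow_mult)
    moreover have "\<bar>j + i\<bar> \<le> int K'" using a le by linarith
    ultimately show "y \<in> ?Y" using a by blast
  qed
  then have "generate G (conjugate (t [^] j) ` ?X) \<subseteq> generate G ?Y" by (rule mono_generate)
  then have "conjugate (t [^] j) ` generate G ?X \<subseteq> generate G ?Y"
    using c.generate_img[OF X] by simp
  then show ?thesis using x unfolding layer_group_def by blast
qed

text \<open>The elements whose base part lies in \<open>C\<close> form a subgroup, as
  \<open>C\<close> is normalised by the powers of \<open>t\<close>. It contains \<open>t\<close> and
  \<open>A\<close>, hence everything, and base elements are their own base parts.\<close>

lemma base_subset_if_normalized: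
  assumes A: "A \<subseteq> C" and gen: "generate G (insert t A) = carrier G"
    and C: "subgroup C G" "C \<subseteq> base_group"
    and t: "\<And>x. x \<in> base_group \<Longrightarrow> conjugate t x \<in> C \<longleftrightarrow> x \<in> C"
  shows "base_group \<subseteq> C"
proof -
  interpret C: subgroup C G by (rule C)
  have t_pow: "conjugate (t [^] (j::int)) x \<in> C" if "x \<in> C" for j x
  proof -
    let ?H = "{g \<in> carrier G. \<forall>x\<in>base_group. conjugate g x \<in> C \<longleftrightarrow> x \<in> C}"
    have "subgroup ?H G" using base_group_subset by (intro normalizer_subgroup) auto
    moreover have "t \<in> ?H" using t by simp
    ultimately have "t [^] j \<in> ?H" by (rule subgroup_int_pow_closed)
    then show ?thesis using that C(2) by blast
  qed
  let ?B = "{x \<in> carrier G. base_part x \<in> C}"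
  have "subgroup ?B G"
  proof (rule subgroupI)
    have "base_part \<one> = \<one>" by (simp add: base_part_def)
    then have "\<one> \<in> ?B" by simp
    then show "?B \<noteq> {}" by blast
  qed (auto simp: base_part_mult base_part_inv t_pow)
  moreover have "insert t A \<subseteq> ?B"
  proof
    fix x assume "x \<in> insert t A"
    then consider "x = t" | "x \<in> C" "x \<in> base_group" using A C by blast
    then show "x \<in> ?B" by cases (simp_all add: base_group_iff[of x])
  qed
  ultimately have "carrier G \<subseteq> ?B" using generate_subgroup_incl gen by metis
  then show ?thesis using base_group_subset by auto
qed

text \<open>An invariant layer would contain the infinite base group. By finiteness, invariance in
  one direction would imply it in both; so some b leaves the layer under conjugation by
  \<open>t\<close>, some c leaves it under the inverse, and d is the conjugate of c outside.\<close>

lemma layer_group_not_invariant: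
  assumes A: "A \<subseteq> base_group" and gen: "generate G (insert t A) = carrier G"
    and inf: "infinite base_group" and fin: "finite (layer_group A K)"
  obtains b d where "b \<in> layer_group A K" "conjugate t b \<notin> layer_group A K"
    "d \<in> base_group" "d \<notin> layer_group A K" "conjugate t d \<in> layer_group A K"
proof -
  let ?C = "layer_group A K"
  note sub = layer_group_subset[OF A, of K]
  have AC: "A \<subseteq> ?C" by (rule layer_group_incl[OF A])
  have no: "\<not> (\<forall>x\<in>base_group. conjugate t x \<in> ?C \<longleftrightarrow> x \<in> ?C)"
  proof
    assume "\<forall>x\<in>base_group. conjugate t x \<in> ?C \<longleftrightarrow> x \<in> ?C"
    then have "base_group \<subseteq> ?C"
      using base_subset_if_normalized[OF AC gen layer_group_subgroup[OF A] sub] by blast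
    then show False using fin inf finite_subset by blast
  qed
  have carr: "?C \<subseteq> carrier G" using sub base_group_subset by blast
  \<comment> \<open>Conjugation is injective, so a conjugation that maps the finite layer into
    itself maps it onto itself.\<close>
  have *: "\<forall>x\<in>base_group. conjugate g x \<in> ?C \<longleftrightarrow> x \<in> ?C"
    if g: "g \<in> carrier G" and inv: "\<And>x. x \<in> ?C \<Longrightarrow> conjugate g x \<in> ?C" for g
  proof
    fix x assume x: "x \<in> base_group"
    have inj: "inj_on (conjugate g) (carrier G)"
      by (rule inj_on_inverseI[of _ "conjugate (inv g)"]) (use g in simp)
    have image: "conjugate g ` ?C = ?C"
      using fin inv inj_on_subset[OF inj carr] by (intro endo_inj_surj) auto
    show "conjugate g x \<in> ?C \<longleftrightarrow> x \<in> ?C"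
      using inj_on_image_mem_iff[OF inj subsetD[OF base_group_subset x] carr] unfolding image .
  qed
  obtain b where b: "b \<in> ?C" "conjugate t b \<notin> ?C"
    using no *[of t] by auto
  have "\<exists>c\<in>?C. conjugate (inv t) c \<notin> ?C"
  proof (rule ccontr)
    assume "\<not> ?thesis"
    then have inv: "\<forall>x\<in>base_group. conjugate (inv t) x \<in> ?C \<longleftrightarrow> x \<in> ?C"
      using *[of "inv t"] by auto
    have tb: "conjugate t b \<in> base_group" "b \<in> carrier G" using b sub carr by auto
    then have "conjugate t b \<in> ?C" using inv[rule_format, OF tb(1)] b(1) by simp
    then show False using b by blast
  qed
  then obtain c where c: "c \<in> ?C" "conjugate (inv t) c \<notin> ?C" by blast
  then have "conjugate (inv t) c \<in> base_group" "conjugate t (conjugate (inv t) c) \<in> ?C"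
    using sub carr by auto
  then show thesis using that b c by blast
qed

text \<open>The relation \<open>\<tau> a \<tau>\<^sup>-\<^sup>1 = t a t\<^sup>-\<^sup>1\<close> within a layer propagates to higher powers of \<open>\<tau>\<close>
  as long as the conjugates stay in that layer.\<close>

lemma conjugate_pow_compatible:
  fixes H (structure)
  assumes H: "group H" and L: "L \<in> hom (G\<lparr>carrier := base_group\<rparr>) H" and \<tau>: "\<tau> \<in> carrier H"
    and A: "A \<subseteq> base_group"
    and comp: "\<And>s. s \<in> layer_group A K \<Longrightarrow> conjugate t s \<in> layer_group A K \<Longrightarrow>
      group.conjugate H \<tau> (L s) = L (conjugate t s)"
    and x: "x \<in> layer_group A K0" and le: "int K0 + \<bar>j\<bar> \<le> int K"
  shows "group.conjugate H (\<tau> [^]\<^bsub>H\<^esub> j) (L x) = L (conjugate (t [^] j) x)"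
proof -
  interpret H: group H by (rule H)
  let ?C = "layer_group A K"
  have xb: "x \<in> base_group" using x A layer_group_subset by blast
  then have xc: "x \<in> carrier G" using base_group_subset by blast
  have Lc: "L y \<in> carrier H" if "y \<in> base_group" for y
    using L that by (auto simp: hom_def)
  have mem: "conjugate (t [^] i) x \<in> ?C" if "\<bar>i\<bar> \<le> \<bar>j\<bar>" for i
    using conjugate_layer_group[OF A x] le that by simp
  have t_step: "conjugate t (conjugate (t [^] i) x) = conjugate (t [^] (i + 1)) x" for i :: int
    using xc int_pow_mult[of t 1 i] by (simp add: conjugate_conjugate add.commute)
  have \<tau>_step: "H.conjugate \<tau> (H.conjugate (\<tau> [^]\<^bsub>H\<^esub> i) (L x)) = H.conjugate (\<tau> [^]\<^bsub>H\<^esub> (i + 1)) (L x)"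
    for i :: int
    using \<tau> Lc[OF xb] H.int_pow_mult[of \<tau> 1 i] by (simp add: H.conjugate_conjugate add.commute)
  have step: "H.conjugate \<tau> (L (conjugate (t [^] i) x)) = L (conjugate (t [^] (i + 1)) x)"
    if "\<bar>i\<bar> \<le> \<bar>j\<bar>" "\<bar>i + 1\<bar> \<le> \<bar>j\<bar>" for i
    using comp[of "conjugate (t [^] i) x"] mem[OF that(1)] mem[OF that(2)] by (simp add: t_step)
  have pos: "H.conjugate (\<tau> [^]\<^bsub>H\<^esub> int m) (L x) = L (conjugate (t [^] int m) x)" if "int m \<le> \<bar>j\<bar>" for m
    using that
  proof (induction m)
    case 0
    then show ?case using Lc[OF xb] xc by simp
  next
    case (Suc m)
    then show ?case using step[of "int m"] \<tau>_step[of "int m"] by (simp add: add.commute)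
  qed
  have neg: "H.conjugate (\<tau> [^]\<^bsub>H\<^esub> (- int m)) (L x) = L (conjugate (t [^] (- int m)) x)"
    if "int m \<le> \<bar>j\<bar>" for m
    using that
  proof (induction m)
    case 0
    then show ?case using Lc[OF xb] xc by simp
  next
    case (Suc m)
    let ?i = "- int (Suc m)"
    have i1: "?i + 1 = - int m" by simp
    have "L (conjugate (t [^] ?i) x) \<in> carrier H" using xb by (intro Lc) simp
    \<comment> \<open>For negative exponents the step relation is read backwards: after conjugation
      by \<open>\<tau>\<close> both sides agree by induction, and the inverse of
      \<open>\<tau>\<close> cancels this conjugation.\<close>
    then have "L (conjugate (t [^] ?i) x)
        = H.conjugate (inv\<^bsub>H\<^esub> \<tau>) (H.conjugate \<tau> (L (conjugate (t [^] ?i) x)))"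
      using \<tau> by simp
    also have "H.conjugate \<tau> (L (conjugate (t [^] ?i) x)) = L (conjugate (t [^] (- int m)) x)"
      using step[of ?i] Suc.prems unfolding i1 by simp
    also have "\<dots> = H.conjugate (\<tau> [^]\<^bsub>H\<^esub> (- int m)) (L x)" using Suc by simp
    also have "\<dots> = H.conjugate \<tau> (H.conjugate (\<tau> [^]\<^bsub>H\<^esub> ?i) (L x))"
      using \<tau>_step[of ?i] unfolding i1 by simp
    also have "H.conjugate (inv\<^bsub>H\<^esub> \<tau>) \<dots> = H.conjugate (\<tau> [^]\<^bsub>H\<^esub> ?i) (L x)"
      using \<tau> Lc[OF xb] by simp
    finally show ?case by simp
  qed
  show ?thesis
    using pos[of "nat j"] neg[of "nat (- j)"] by (cases "0 \<le> j") simp_all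
qed

section \<open>What finitely many relators see of the base group\<close>

text \<open>\<open>A\<close> consists of the base parts of the images of the free generators, and
  \<open>K\<close> is wide enough to evaluate all relators. Any \<open>\<tau>\<close> imitating
  \<open>t\<close> on this layer defines a homomorphism from the free group to \<open>H\<close> that
  kills the relators. So it kills the whole kernel of \<open>p\<close>, in particular the
  commutators that are trivial because the base group is abelian.\<close>

lemma finite_presentation_layer:
  fixes H (structure)
  assumes fp: "finitely_presented G" and H: "group H"
    and comm: "\<And>x y. x \<in> base_group \<Longrightarrow> y \<in> base_group \<Longrightarrow> x \<otimes>\<^bsub>G\<^esub> y = y \<otimes>\<^bsub>G\<^esub> x"
    and L: "L \<in> hom (G\<lparr>carrier := base_group\<rparr>) H"
  shows "\<exists>A K. finite A \<and> A \<subseteq> base_group \<and> generate G (insert t A) = carrier G \<and>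
    (\<forall>\<tau>\<in>carrier H.
      (\<forall>s\<in>layer_group A K. conjugate t s \<in> layer_group A K \<longrightarrow>
        group.conjugate H \<tau> (L s) = L (conjugate t s)) \<longrightarrow>
      (\<forall>b\<in>layer_group A K. \<forall>c\<in>layer_group A K.
        group.conjugate H \<tau> (L b) \<otimes>\<^bsub>H\<^esub> L c = L c \<otimes>\<^bsub>H\<^esub> group.conjugate H \<tau> (L b)))"
proof -
  interpret H: group H by (rule H)
  obtain n :: nat and R p where R: "finite R" "R \<subseteq> carrier (free_group {..<n})"
    and p: "p \<in> epi (free_group {..<n}) G"
    and ker_p: "kernel (free_group {..<n}) G p = normal_closure (free_group {..<n}) R"
    using fp unfolding finitely_presented_iff[OF is_group] by blast
  let ?F = "free_group {..<n}"
  let ?X = "free_gen {..<n} ` {..<n}"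
  interpret p: group_hom ?F G p using p by (simp add: group_hom_epi)
  have X: "?X \<subseteq> carrier ?F" by auto
  have genX: "generate ?F ?X = carrier ?F" by (rule generate_free_group)
  have p_surj: "p ` carrier ?F = carrier G" using p by (simp add: epi_def)
  define A where "A = base_part ` p ` ?X"
  have A: "finite A" "A \<subseteq> base_group"
    using X by (auto simp: A_def base_part_mem)
  have pX_gen: "p x \<in> generate G (insert t A)" if "x \<in> ?X" for x
  proof -
    have sub: "subgroup (generate G (insert t A)) G"
      using A base_group_subset by (intro generate_is_subgroup) auto
    have "t \<in> generate G (insert t A)" "base_part (p x) \<in> generate G (insert t A)"
      using that by (auto intro: generate.incl simp: A_def)
    then have "base_part (p x) \<otimes>\<^bsub>G\<^esub> t [^]\<^bsub>G\<^esub> \<pi> (p x) \<in> generate G (insert t A)"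
      using subgroup_int_pow_closed[OF sub] subgroup.m_closed[OF sub] by blast
    moreover have "p x \<in> carrier G" using that X by auto
    ultimately show ?thesis using base_part_decomp[of "p x"] by simp
  qed
  have gen: "generate G (insert t A) = carrier G"
  proof
    show "generate G (insert t A) \<subseteq> carrier G"
      using A base_group_subset by (intro generate_incl) auto
    have "generate G (p ` ?X) = carrier G"
      using p.generate_img[OF X] genX p_surj by simp
    moreover have "generate G (p ` ?X) \<subseteq> generate G (insert t A)"
      using pX_gen A base_group_subset
      by (intro generate_subgroup_incl generate_is_subgroup) auto
    ultimately show "carrier G \<subseteq> generate G (insert t A)" by simp
  qed
  have M: "group (G\<lparr>carrier := base_group\<rparr>)"
    by (rule subgroup_imp_group[OF normal_imp_subgroup[OF base_group_normal]])
  interpret L: group_hom "G\<lparr>carrier := base_group\<rparr>" H L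
    using M H L by (simp add: group_hom_def group_hom_axioms_def)
  interpret B: subgroup base_group G by (rule normal_imp_subgroup[OF base_group_normal])
  have L_mult: "L (x \<otimes>\<^bsub>G\<^esub> y) = L x \<otimes>\<^bsub>H\<^esub> L y" if "x \<in> base_group" "y \<in> base_group" for x y
    using L.hom_mult that by simp
  have L_closed [simp]: "L x \<in> carrier H" if "x \<in> base_group" for x
    using L.hom_closed that by simp
  have L_one: "L \<one>\<^bsub>G\<^esub> = \<one>\<^bsub>H\<^esub>" using L.hom_one by simp
  have L_inv: "L (inv\<^bsub>G\<^esub> x) = inv\<^bsub>H\<^esub> L x" if "x \<in> base_group" for x
    using L.hom_inv[of x] that unfolding m_inv_consistent[OF B.is_subgroup that] by simp
  define compatible where "compatible K \<tau> \<longleftrightarrow> \<tau> \<in> carrier H \<and>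
    (\<forall>s\<in>layer_group A K. conjugate t s \<in> layer_group A K \<longrightarrow>
        H.conjugate \<tau> (L s) = L (conjugate t s))" for K \<tau>
  have conj_pow: "H.conjugate (\<tau> [^]\<^bsub>H\<^esub> j) (L x) = L (conjugate (t [^]\<^bsub>G\<^esub> j) x)"
    if "compatible K \<tau>" "x \<in> layer_group A K0" "int K0 + \<bar>j\<bar> \<le> int K" for K \<tau> j x K0
    using that by (intro conjugate_pow_compatible[OF H L _ A(2)]) (auto simp: compatible_def)
  \<comment> \<open>The value at x of an extension of \<open>L\<close> that would send
    \<open>t\<close> to \<open>\<tau>\<close>. No such homomorphism on all of \<open>G\<close> is
    assumed; multiplicativity holds only where conjugates stay in a common layer.\<close>
  define val where "val \<tau> x = L (base_part x) \<otimes>\<^bsub>H\<^esub> \<tau> [^]\<^bsub>H\<^esub> \<pi> x" for \<tau> x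
  define lift where "lift K \<tau> \<psi> \<longleftrightarrow>
    compatible K \<tau> \<and> \<psi> \<in> hom ?F H \<and> (\<forall>x\<in>?X. \<psi> x = val \<tau> (p x))" for K \<tau> \<psi>
  \<comment> \<open>The width \<open>K0\<close> is chosen before \<open>K\<close>,
    \<open>\<tau>\<close> and \<open>\<psi>\<close>. This uniformity permits a single width for all
    relators, fixed before \<open>\<tau>\<close> is known.\<close>
  define good where "good K0 g \<longleftrightarrow> base_part (p g) \<in> layer_group A K0 \<and>
    (\<forall>K\<ge>K0. \<forall>\<tau> \<psi>. lift K \<tau> \<psi> \<longrightarrow> \<psi> g = val \<tau> (p g))" for K0 g
  have goodD: "\<psi> g = val \<tau> (p g)" if "good K0 g" "K0 \<le> K" "lift K \<tau> \<psi>" for K0 g K \<tau> \<psi>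
    using that unfolding good_def by blast
  have lift_hom: "group_hom ?F H \<psi>" if "lift K \<tau> \<psi>" for K \<tau> \<psi>
    using that by (simp add: lift_def group_hom_def group_hom_axioms_def)
  have layer_sub: "subgroup (layer_group A K) G" for K
    by (rule layer_group_subgroup[OF A(2)])
  have "subgroup {g \<in> carrier ?F. \<exists>K0. good K0 g} ?F" (is "subgroup ?S ?F")
  proof (rule p.G.subgroupI)
    have val_one: "val \<tau> \<one>\<^bsub>G\<^esub> = \<one>\<^bsub>H\<^esub>" for \<tau>
      by (simp add: val_def L_one base_part_def)
    have "base_part \<one>\<^bsub>G\<^esub> \<in> layer_group A 0"
      using subgroup.one_closed[OF layer_sub] by (simp add: base_part_def)
    then have "good 0 \<one>\<^bsub>?F\<^esub>"
      unfolding good_def p.hom_one val_one using group_hom.hom_one[OF lift_hom] by blast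
    then show "?S \<noteq> {}" by blast
    fix g assume "g \<in> ?S"
    then obtain K1 where g: "g \<in> carrier ?F" and K1: "good K1 g" by auto
    have pg [simp]: "p g \<in> carrier G" using g by simp
    have bg: "base_part (p g) \<in> layer_group A K1" using K1 by (simp add: good_def)
    \<comment> \<open>Restoring the normal form of the inverse moves a power of \<open>t\<close>
      across the base part. The conjugation needed for this accounts for the wider layer.\<close>
    have "good (K1 + nat \<bar>\<pi> (p g)\<bar>) (inv\<^bsub>?F\<^esub> g)"
      unfolding good_def
    proof (intro conjI allI impI)
      have inv_mem: "inv\<^bsub>G\<^esub> base_part (p g) \<in> layer_group A K1"
        using bg by (rule subgroup.m_inv_closed[OF layer_sub])
      have bp: "base_part (p (inv\<^bsub>?F\<^esub> g)) =
          conjugate (t [^]\<^bsub>G\<^esub> (- \<pi> (p g))) (inv\<^bsub>G\<^esub> base_part (p g))"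
        using g by (simp add: base_part_inv)
      show "base_part (p (inv\<^bsub>?F\<^esub> g)) \<in> layer_group A (K1 + nat \<bar>\<pi> (p g)\<bar>)"
        unfolding bp using inv_mem by (rule conjugate_layer_group[OF A(2)]) simp
      fix K \<tau> \<psi> assume K: "K1 + nat \<bar>\<pi> (p g)\<bar> \<le> K" and lift: "lift K \<tau> \<psi>"
      interpret \<psi>: group_hom ?F H \<psi> by (rule lift_hom[OF lift])
      have comp: "compatible K \<tau>" and \<tau>: "\<tau> \<in> carrier H"
        using lift by (auto simp: lift_def compatible_def)
      have "\<psi> (inv\<^bsub>?F\<^esub> g) = inv\<^bsub>H\<^esub> val \<tau> (p g)"
        using goodD[OF K1 _ lift] K g by simp
      also have "\<dots> = \<tau> [^]\<^bsub>H\<^esub> (- \<pi> (p g)) \<otimes>\<^bsub>H\<^esub> L (inv\<^bsub>G\<^esub> base_part (p g))"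
        using \<tau> by (simp add: val_def H.inv_mult_group H.int_pow_neg L_inv base_part_mem)
      also have "\<dots> = H.conjugate (\<tau> [^]\<^bsub>H\<^esub> (- \<pi> (p g))) (L (inv\<^bsub>G\<^esub> base_part (p g)))
          \<otimes>\<^bsub>H\<^esub> \<tau> [^]\<^bsub>H\<^esub> (- \<pi> (p g))"
        using \<tau> by (intro H.conjugate_mult_self[symmetric]) (simp_all add: base_part_mem)
      also have "H.conjugate (\<tau> [^]\<^bsub>H\<^esub> (- \<pi> (p g))) (L (inv\<^bsub>G\<^esub> base_part (p g)))
          = L (base_part (p (inv\<^bsub>?F\<^esub> g)))"
        unfolding bp using K by (intro conj_pow[OF comp inv_mem]) simp
      finally show "\<psi> (inv\<^bsub>?F\<^esub> g) = val \<tau> (p (inv\<^bsub>?F\<^esub> g))"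
        using g by (simp add: val_def)
    qed
    then show "inv\<^bsub>?F\<^esub> g \<in> ?S" using g by auto
    fix h assume "h \<in> ?S"
    then obtain K2 where h: "h \<in> carrier ?F" and K2: "good K2 h" by auto
    have ph [simp]: "p h \<in> carrier G" using h by simp
    have bh: "base_part (p h) \<in> layer_group A K2" using K2 by (simp add: good_def)
    \<comment> \<open>A convenient common bound: the left factor needs width \<open>K1\<close>, and
      the right one \<open>K2\<close> plus the absolute value of the exponent by which its base part
      is conjugated.\<close>
    let ?K = "K1 + K2 + nat \<bar>\<pi> (p g)\<bar>"
    have "good ?K (g \<otimes>\<^bsub>?F\<^esub> h)"
      unfolding good_def
    proof (intro conjI allI impI)
      have bp: "base_part (p (g \<otimes>\<^bsub>?F\<^esub> h)) =
          base_part (p g) \<otimes>\<^bsub>G\<^esub> conjugate (t [^]\<^bsub>G\<^esub> \<pi> (p g)) (base_part (p h))"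
        using g h by (simp add: base_part_mult)
      have "base_part (p g) \<in> layer_group A ?K"
        using bg layer_group_mono[of K1 ?K A] by auto
      moreover have "conjugate (t [^]\<^bsub>G\<^esub> \<pi> (p g)) (base_part (p h)) \<in> layer_group A ?K"
        using bh by (rule conjugate_layer_group[OF A(2)]) simp
      ultimately show "base_part (p (g \<otimes>\<^bsub>?F\<^esub> h)) \<in> layer_group A ?K"
        unfolding bp by (rule subgroup.m_closed[OF layer_sub])
      fix K \<tau> \<psi> assume K: "?K \<le> K" and lift: "lift K \<tau> \<psi>"
      interpret \<psi>: group_hom ?F H \<psi> by (rule lift_hom[OF lift])
      have comp: "compatible K \<tau>" and \<tau>: "\<tau> \<in> carrier H"
        using lift by (auto simp: lift_def compatible_def)
      let ?tg = "\<tau> [^]\<^bsub>H\<^esub> \<pi> (p g)" and ?th = "\<tau> [^]\<^bsub>H\<^esub> \<pi> (p h)"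
      have "\<psi> (g \<otimes>\<^bsub>?F\<^esub> h) = val \<tau> (p g) \<otimes>\<^bsub>H\<^esub> val \<tau> (p h)"
        using goodD[OF K1 _ lift] goodD[OF K2 _ lift] K g h by simp
      also have "\<dots> = L (base_part (p g)) \<otimes>\<^bsub>H\<^esub> (?tg \<otimes>\<^bsub>H\<^esub> L (base_part (p h))) \<otimes>\<^bsub>H\<^esub> ?th"
        using \<tau> by (simp add: val_def H.m_assoc base_part_mem)
      also have "?tg \<otimes>\<^bsub>H\<^esub> L (base_part (p h)) = H.conjugate ?tg (L (base_part (p h))) \<otimes>\<^bsub>H\<^esub> ?tg"
        using \<tau> by (intro H.conjugate_mult_self[symmetric]) (simp_all add: base_part_mem)
      also have "H.conjugate ?tg (L (base_part (p h)))
          = L (conjugate (t [^]\<^bsub>G\<^esub> \<pi> (p g)) (base_part (p h)))"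
        using K by (intro conj_pow[OF comp bh]) simp
      finally show "\<psi> (g \<otimes>\<^bsub>?F\<^esub> h) = val \<tau> (p (g \<otimes>\<^bsub>?F\<^esub> h))"
        unfolding val_def bp using \<tau> g h
        by (simp add: L_mult base_part_mem H.m_assoc H.int_pow_mult)
    qed
    then show "g \<otimes>\<^bsub>?F\<^esub> h \<in> ?S" using g h by auto
  qed auto
  moreover have "?X \<subseteq> ?S"
  proof
    fix x assume x: "x \<in> ?X"
    then have "good 0 x"
      using layer_group_incl[OF A(2), of 0] by (auto simp: good_def lift_def A_def)
    then show "x \<in> ?S" using x by auto
  qed
  ultimately have "generate ?F ?X \<subseteq> ?S"
    by (intro p.G.generate_subgroup_incl)
  then have "\<forall>g\<in>carrier ?F. \<exists>K0. good K0 g"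
    unfolding genX by blast
  then have "\<exists>k. \<forall>g\<in>carrier ?F. good (k g) g"
    by (rule bchoice)
  then obtain k where k: "\<And>g. g \<in> carrier ?F \<Longrightarrow> good (k g) g"
    by blast
  obtain gt where gt: "gt \<in> carrier ?F" "p gt = t"
    using t_closed unfolding p_surj[symmetric] by blast
  \<comment> \<open>A preimage of \<open>t\<close> is included along with the relators so that its
    image under the lifted homomorphism is exactly \<open>\<tau>\<close>.\<close>
  define K where "K = Max (insert (k gt) (k ` R))"
  have K_gt: "k gt \<le> K" and K_R: "\<And>r. r \<in> R \<Longrightarrow> k r \<le> K"
    using R by (auto simp: K_def)
  have "H.conjugate \<tau> (L b) \<otimes>\<^bsub>H\<^esub> L c = L c \<otimes>\<^bsub>H\<^esub> H.conjugate \<tau> (L b)"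
    if comp: "compatible K \<tau>" and b: "b \<in> layer_group A K" and c: "c \<in> layer_group A K" for \<tau> b c
  proof -
    have \<tau>: "\<tau> \<in> carrier H" using comp by (simp add: compatible_def)
    have "(\<lambda>i. val \<tau> (p (free_gen {..<n} i))) \<in> {..<n} \<rightarrow> carrier H"
      using \<tau> by (auto simp: val_def base_part_mem)
    then obtain \<psi> where \<psi>: "\<psi> \<in> hom ?F H"
      "\<And>i. i \<in> {..<n} \<Longrightarrow> \<psi> (free_gen {..<n} i) = val \<tau> (p (free_gen {..<n} i))"
      by (rule H.free_group_lift) blast
    then have lift: "lift K \<tau> \<psi>" using comp by (auto simp: lift_def)
    interpret \<psi>: group_hom ?F H \<psi> by (rule lift_hom[OF lift])
    \<comment> \<open>Relators are evaluated correctly in width \<open>K\<close>, and their normal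
      form in \<open>G\<close> is trivial. Since \<open>\<psi>\<close> has a normal kernel, it also
      kills the normal closure.\<close>
    have ker: "kernel ?F G p \<subseteq> kernel ?F H \<psi>"
      unfolding ker_p
    proof (rule p.G.normal_closure_least[OF \<psi>.normal_kernel], rule subsetI)
      fix r assume r: "r \<in> R"
      then have "r \<in> kernel ?F G p" using ker_p p.G.normal_closure_incl by blast
      then have pr: "p r = \<one>\<^bsub>G\<^esub>" by (simp add: kernel_def)
      have rF: "r \<in> carrier ?F" using r R by blast
      have "\<psi> r = val \<tau> (p r)" by (rule goodD[OF k[OF rF] K_R[OF r] lift])
      also have "\<dots> = \<one>\<^bsub>H\<^esub>" by (simp add: pr val_def L_one)
      finally show "r \<in> kernel ?F H \<psi>" using rF by (simp add: kernel_def)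
    qed
    have \<psi>_gt: "\<psi> gt = \<tau>"
    proof -
      have "\<psi> gt = val \<tau> (p gt)" by (rule goodD[OF k[OF gt(1)] K_gt lift])
      then show ?thesis using \<tau> gt by (simp add: val_def L_one)
    qed
    \<comment> \<open>The base elements having a preimage on which \<open>\<psi>\<close> takes the
      value prescribed by \<open>L\<close>. It suffices to find such preimages for the generators of
      the layer.\<close>
    let ?B = "{x \<in> base_group. \<exists>g\<in>carrier ?F. p g = x \<and> \<psi> g = L x}"
    have "subgroup ?B G"
    proof (rule subgroupI)
      show "?B \<subseteq> carrier G" using base_group_subset by blast
      have "\<one>\<^bsub>G\<^esub> \<in> ?B" using L_one by (auto intro!: bexI[of _ "\<one>\<^bsub>?F\<^esub>"])
      then show "?B \<noteq> {}" by blast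
      fix x assume "x \<in> ?B"
      then obtain g where g: "x \<in> base_group" "g \<in> carrier ?F" "p g = x" "\<psi> g = L x" by blast
      then show "inv\<^bsub>G\<^esub> x \<in> ?B" using L_inv by (auto intro!: bexI[of _ "inv\<^bsub>?F\<^esub> g"])
      fix y assume "y \<in> ?B"
      then obtain h where h: "y \<in> base_group" "h \<in> carrier ?F" "p h = y" "\<psi> h = L y" by blast
      then show "x \<otimes>\<^bsub>G\<^esub> y \<in> ?B" using g L_mult by (auto intro!: bexI[of _ "g \<otimes>\<^bsub>?F\<^esub> h"])
    qed
    moreover have "{conjugate (t [^]\<^bsub>G\<^esub> j) a | j a. a \<in> A \<and> \<bar>j\<bar> \<le> int K} \<subseteq> ?B"
    proof
      fix y assume "y \<in> {conjugate (t [^]\<^bsub>G\<^esub> j) a | j a. a \<in> A \<and> \<bar>j\<bar> \<le> int K}"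
      then obtain j a where y: "y = conjugate (t [^]\<^bsub>G\<^esub> j) a" "a \<in> A" "\<bar>j\<bar> \<le> int K" by blast
      then obtain x where x: "x \<in> ?X" "a = base_part (p x)" by (auto simp: A_def)
      have xF: "x \<in> carrier ?F" using x X by blast
      have aB: "a \<in> base_group" using y A by blast
      \<comment> \<open>A preimage of the base part \<open>a\<close>: the factor with
        \<open>gt\<close> cancels the exponent of \<open>p x\<close>. Its conjugates by powers of
        \<open>gt\<close> then lie above the generators of the layer.\<close>
      let ?g = "x \<otimes>\<^bsub>?F\<^esub> gt [^]\<^bsub>?F\<^esub> (- \<pi> (p x))"
      let ?c = "p.G.conjugate (gt [^]\<^bsub>?F\<^esub> j) ?g"
      have pg: "p ?g = a" using xF gt p.hom_int_pow[OF gt(1)] by (simp add: x(2) base_part_def)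
      have \<psi>_x: "\<psi> x = val \<tau> (p x)" using lift x(1) unfolding lift_def by blast
      have "\<psi> ?g = val \<tau> (p x) \<otimes>\<^bsub>H\<^esub> \<tau> [^]\<^bsub>H\<^esub> (- \<pi> (p x))"
        using xF gt \<psi>.hom_int_pow[OF gt(1)] by (simp add: \<psi>_gt \<psi>_x)
      also have "\<dots> = L a"
        using \<tau> aB by (simp add: val_def x(2) H.m_assoc H.int_pow_neg)
      finally have \<psi>g: "\<psi> ?g = L a" .
      have "p ?c = y"
        using xF gt p.hom_int_pow[OF gt(1)] pg by (simp only: p.hom_conjugate p.G.int_pow_closed p.G.m_closed y(1))
      moreover have "\<psi> ?c = H.conjugate (\<tau> [^]\<^bsub>H\<^esub> j) (L a)"
        using xF gt \<psi>.hom_int_pow[OF gt(1)] \<psi>g \<psi>_gt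
        by (simp only: \<psi>.hom_conjugate p.G.int_pow_closed p.G.m_closed)
      moreover have "H.conjugate (\<tau> [^]\<^bsub>H\<^esub> j) (L a) = L y"
        unfolding y(1) using y layer_group_incl[OF A(2), of 0]
        by (intro conj_pow[OF comp, of a 0]) auto
      moreover have "?c \<in> carrier ?F" using xF gt by simp
      moreover have "y \<in> base_group" using y(1) aB by simp
      ultimately show "y \<in> ?B" by auto
    qed
    ultimately have "layer_group A K \<subseteq> ?B"
      unfolding layer_group_def by (rule generate_subgroup_incl[rotated])
    then obtain gb gc where gb: "gb \<in> carrier ?F" "p gb = b" "\<psi> gb = L b" "b \<in> base_group"
      and gc: "gc \<in> carrier ?F" "p gc = c" "\<psi> gc = L c" "c \<in> base_group"
      using b c by blast
    let ?u = "p.G.conjugate gt gb"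
    have u: "?u \<in> carrier ?F" "p ?u = conjugate t b" "\<psi> ?u = H.conjugate \<tau> (L b)"
      using gt gb \<psi>_gt by (simp_all add: p.hom_conjugate \<psi>.hom_conjugate)
    \<comment> \<open>The commutator of lifts of t b t^-1 and c. It is trivial in \<open>G\<close>
      because the base group is abelian, so \<open>\<psi>\<close> kills it as well.\<close>
    let ?w = "?u \<otimes>\<^bsub>?F\<^esub> gc \<otimes>\<^bsub>?F\<^esub> inv\<^bsub>?F\<^esub> ?u \<otimes>\<^bsub>?F\<^esub> inv\<^bsub>?F\<^esub> gc"
    have cb: "conjugate t b \<in> base_group" using gb by simp
    have "p ?w = conjugate t b \<otimes>\<^bsub>G\<^esub> c \<otimes>\<^bsub>G\<^esub> inv\<^bsub>G\<^esub> conjugate t b \<otimes>\<^bsub>G\<^esub> inv\<^bsub>G\<^esub> c"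
      using u gc by simp
    also have "\<dots> = \<one>\<^bsub>G\<^esub>"
      using comm[OF cb gc(4)] cb gc(4) base_group_subset by (subst commutator_eq_one_iff) auto
    finally have "?w \<in> kernel ?F G p" using u gc by (simp add: kernel_def)
    then have "\<psi> ?w = \<one>\<^bsub>H\<^esub>" using ker by (auto simp: kernel_def)
    then have "H.conjugate \<tau> (L b) \<otimes>\<^bsub>H\<^esub> L c \<otimes>\<^bsub>H\<^esub> inv\<^bsub>H\<^esub> H.conjugate \<tau> (L b) \<otimes>\<^bsub>H\<^esub> inv\<^bsub>H\<^esub> L c = \<one>\<^bsub>H\<^esub>"
      using u gc by simp
    then show ?thesis
      using \<tau> gb gc by (subst (asm) H.commutator_eq_one_iff) auto
  qed
  then show ?thesis
    using A gen unfolding compatible_def by (intro exI[of _ A] exI[of _ K]) blast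
qed

lemma metabelian_if_base_comm:
  assumes comm: "\<And>x y. x \<in> base_group \<Longrightarrow> y \<in> base_group \<Longrightarrow> x \<otimes> y = y \<otimes> x"
  shows "metabelian G"
proof -
  let ?D = "derived G (carrier G)"
  have "derived_set G (carrier G) \<subseteq> base_group"
    by (auto simp: base_group_iff)
  then have D: "?D \<subseteq> base_group"
    unfolding derived_def
    by (intro generate_subgroup_incl normal_imp_subgroup[OF base_group_normal])
  have "derived_set G ?D \<subseteq> {\<one>}"
  proof
    fix z assume "z \<in> derived_set G ?D"
    then obtain x y where xy: "x \<in> ?D" "y \<in> ?D" "z = x \<otimes> y \<otimes> inv x \<otimes> inv y" by blast
    then have "x \<in> base_group" "y \<in> base_group" using D by auto
    then show "z \<in> {\<one>}"
      using commutator_eq_one_iff[of x y] comm[of x y] base_group_subset xy(3) by blast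
  qed
  then have "derived G ?D \<subseteq> {\<one>}"
    unfolding derived_def[of _ ?D] by (intro generate_subgroup_incl triv_subgroup)
  moreover have "\<one> \<in> derived G ?D" unfolding derived_def[of _ ?D] by (rule generate.one)
  ultimately show ?thesis unfolding metabelian_def second_derived_def by blast
qed

theorem not_finitely_presented:
  assumes comm: "\<And>x y. x \<in> base_group \<Longrightarrow> y \<in> base_group \<Longrightarrow> x \<otimes> y = y \<otimes> x"
    and inf: "infinite base_group"
    and fin: "\<And>S. S \<subseteq> base_group \<Longrightarrow> finite S \<Longrightarrow> finite (generate G S)"
  shows "\<not> finitely_presented G"
proof
  assume fp: "finitely_presented G"
  let ?M = "G\<lparr>carrier := base_group\<rparr>"
  let ?P = "permutation_group :: ('a \<Rightarrow> 'a) monoid"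
  \<comment> \<open>The base group acts regularly on its own elements. Permutations of this set are
    numerous enough to contain a suitable \<open>\<tau>\<close>.\<close>
  let ?L = "translation ?M"
  have base_sub: "subgroup base_group G" by (rule normal_imp_subgroup[OF base_group_normal])
  have "group ?M" by (rule subgroup_imp_group[OF base_sub])
  then interpret M: comm_group ?M by (rule group.group_comm_groupI) (simp add: comm)
  interpret P: group ?P by simp
  obtain A K where A: "finite A" "A \<subseteq> base_group" "generate G (insert t A) = carrier G"
    and commute: "\<forall>\<tau>\<in>carrier ?P.
      (\<forall>s\<in>layer_group A K. conjugate t s \<in> layer_group A K \<longrightarrow>
        P.conjugate \<tau> (?L s) = ?L (conjugate t s)) \<longrightarrow>
      (\<forall>b\<in>layer_group A K. \<forall>c\<in>layer_group A K.
        P.conjugate \<tau> (?L b) \<otimes>\<^bsub>?P\<^esub> ?L c = ?L c \<otimes>\<^bsub>?P\<^esub> P.conjugate \<tau> (?L b))"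
    using finite_presentation_layer[OF fp P.is_group comm M.translation_hom] by blast
  let ?C = "layer_group A K"
  interpret C: subgroup ?C G by (rule layer_group_subgroup[OF A(2)])
  have C_sub: "?C \<subseteq> base_group" by (rule layer_group_subset[OF A(2)])
  have finC: "finite ?C"
    unfolding layer_group_def
  proof (rule fin[OF layer_gens_closed[OF A(2)]])
    have "finite ((\<lambda>(j, a). conjugate (t [^] j) a) ` ({- int K..int K} \<times> A))" using A by simp
    then show "finite {conjugate (t [^] j) a | j a. a \<in> A \<and> \<bar>j::int\<bar> \<le> int K}"
      by (rule rev_finite_subset) force
  qed
  obtain b d where b: "b \<in> ?C" "conjugate t b \<notin> ?C"
    and d: "d \<in> base_group" "d \<notin> ?C" "conjugate t d \<in> ?C"
    using layer_group_not_invariant[OF A(2,3) inf finC] by blast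
  \<comment> \<open>The domain of the partial isomorphism that \<open>t\<close> induces on the
    layer. Here b is outside because its conjugate leaves the layer, and d because it does not
    belong to the layer; since b does belong, b d is outside as well.\<close>
  define S where "S = {s \<in> ?C. conjugate t s \<in> ?C}"
  interpret c: group_hom G G "conjugate t" by (rule conjugate_hom) simp
  have "subgroup S G"
  proof (rule subgroupI)
    have "\<one> \<in> S" using c.hom_one by (simp add: S_def)
    then show "S \<noteq> {}" by blast
  qed (auto simp: S_def)
  then have S: "subgroup S ?M"
    using C_sub by (intro subgroup_incl[OF _ base_sub]) (auto simp: S_def)
  have \<theta>: "conjugate t \<in> iso ?M ?M"
  proof (rule isoI)
    show "conjugate t \<in> hom ?M ?M"
      using base_group_subset by (intro homI) (auto intro!: conjugate_mult)
    show "bij_betw (conjugate t) (carrier ?M) (carrier ?M)"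
      using base_group_subset by (intro bij_betw_byWitness[of _ "conjugate (inv t)"]) auto
  qed
  have "b \<otimes> d \<notin> S"
  proof
    assume "b \<otimes> d \<in> S"
    then have "inv b \<otimes> (b \<otimes> d) \<in> ?C" using b by (auto simp: S_def)
    moreover have "d \<in> carrier G" using d base_group_subset by blast
    ultimately show False using b d by (simp add: inv_mult_cancel)
  qed
  then obtain \<tau> where \<tau>: "\<tau> \<in> carrier ?P"
    "\<And>s. s \<in> S \<Longrightarrow> P.conjugate \<tau> (?L s) = ?L (conjugate t s)"
    "P.conjugate \<tau> (?L b) \<circ> ?L (conjugate t d) \<noteq> ?L (conjugate t d) \<circ> P.conjugate \<tau> (?L b)"
    using M.twisted_permutation[OF _ \<theta> S, of b d] inf finC b d C_sub by (auto simp: S_def)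
  \<comment> \<open>The conjugate of d lies in the layer, so \<open>commute\<close> applies to it
    together with b and contradicts the choice of \<open>\<tau>\<close>.\<close>
  then show False
    using commute b(1) d(3) by (simp add: S_def)
qed

end

section \<open>Metabelian tops and wreath products\<close>

context group
begin

lemma second_derived_normal: "second_derived G \<lhd> G"
  unfolding second_derived_def by (intro derived_is_normal derived_self_is_normal)

lemma group_metabelian_top: "group (metabelian_top G)"
  unfolding metabelian_top_def by (rule normal.factorgroup_is_group[OF second_derived_normal])

end

lemma second_derived_epi:
  assumes "group G" "group H" "p \<in> epi G H"
  shows "second_derived H = p ` second_derived G"
proof -
  interpret group_hom G H p using assms by (rule group_hom_epi)
  have "p ` carrier G = carrier H" using assms by (simp add: epi_def)
  then show ?thesis
    using derived_img[of "carrier G"] derived_img[OF G.derived_in_carrier[of "carrier G"]]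
    by (simp add: second_derived_def)
qed

lemma metabelian_metabelian_top:
  assumes "group G"
  shows "metabelian (metabelian_top G)"
proof -
  interpret group G by fact
  interpret N: normal "second_derived G" G by (rule second_derived_normal)
  have "second_derived (metabelian_top G) = (\<lambda>x. second_derived G #>\<^bsub>G\<^esub> x) ` second_derived G"
    unfolding metabelian_top_def
    by (rule second_derived_epi[OF _ N.factorgroup_is_group FactGroup_natural_epi]) unfold_locales
  also have "\<dots> = {second_derived G}"
    by (simp add: N.rcos_const[OF is_group] image_constant[OF N.one_closed] cong: image_cong_simp)
  finally show ?thesis by (simp add: metabelian_def metabelian_top_def)
qed

text \<open>An epimorphism carries the second derived group onto that of the target, which is
  trivial; so it factors through the metabelian top.\<close>

lemma metabelian_top_maps_onto:
  assumes "group G" "group M" "metabelian M" "maps_onto G M"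
  shows "maps_onto (metabelian_top G) M"
proof -
  interpret group G by fact
  obtain p where p: "p \<in> epi G M" using assms by (auto simp: maps_onto_def)
  interpret p: group_hom G M p using assms p by (intro group_hom_epi)
  have "p ` second_derived G = {\<one>\<^bsub>M\<^esub>}"
    using second_derived_epi[OF assms(1,2) p] assms(3) by (simp add: metabelian_def)
  then have "second_derived G \<subseteq> kernel G M p"
    using subgroup.subset[OF normal_imp_subgroup[OF second_derived_normal]]
    by (auto simp: kernel_def)
  then obtain g where g: "g \<in> hom (metabelian_top G) M"
    "\<And>x. x \<in> carrier G \<Longrightarrow> g (second_derived G #>\<^bsub>G\<^esub> x) = p x"
    unfolding metabelian_top_def
    using p.FactGroup_universal_kernel[OF second_derived_normal] by metis
  have "g ` carrier (metabelian_top G) = p ` carrier G"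
    using g(2) by (auto simp: metabelian_top_def carrier_FactGroup image_iff)
  then have "g \<in> epi (metabelian_top G) M" using g(1) p by (simp add: epi_def)
  then show ?thesis by (auto simp: maps_onto_def)
qed

lemma metabelian_top_finitely_presented_quotient:
  assumes "group G" "finitely_presented (metabelian_top G)"
    and "group M" "metabelian M" "maps_onto G M"
  shows "finitely_presented M"
  by (rule metabelian_finitely_presented_quotient[OF group.group_metabelian_top[OF assms(1)]
        metabelian_metabelian_top[OF assms(1)] assms(2,3) metabelian_top_maps_onto[OF assms(1,3,4,5)]])

section \<open>Semidirect products and images inside them\<close>

lemma semidirect_product_simps [simp]:
  "carrier (semidirect_product N Q \<phi>) = carrier N \<times> carrier Q"
  "(a, q) \<otimes>\<^bsub>semidirect_product N Q \<phi>\<^esub> (b, r) = (a \<otimes>\<^bsub>N\<^esub> \<phi> q b, q \<otimes>\<^bsub>Q\<^esub> r)"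
  "\<one>\<^bsub>semidirect_product N Q \<phi>\<^esub> = (\<one>\<^bsub>N\<^esub>, \<one>\<^bsub>Q\<^esub>)"
  by (simp_all add: semidirect_product_def)

lemma AutoGroup_action:
  assumes "group N" "group Q" and \<phi>: "\<phi> \<in> hom Q (AutoGroup N)"
  shows "q \<in> carrier Q \<Longrightarrow> \<phi> q \<in> hom N N"
    and "q \<in> carrier Q \<Longrightarrow> r \<in> carrier Q \<Longrightarrow> x \<in> carrier N \<Longrightarrow> \<phi> (q \<otimes>\<^bsub>Q\<^esub> r) x = \<phi> q (\<phi> r x)"
    and "x \<in> carrier N \<Longrightarrow> \<phi> \<one>\<^bsub>Q\<^esub> x = x"
proof -
  have auto: "\<phi> q \<in> auto N" if "q \<in> carrier Q" for q
    using hom_in_carrier[OF \<phi> that] by (simp add: AutoGroup_def)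
  then show "\<phi> q \<in> hom N N" if "q \<in> carrier Q" for q
    using that by (auto simp: auto_def)
  have Bij: "\<phi> q \<in> Bij (carrier N)" if "q \<in> carrier Q" for q
    using auto[OF that] by (simp add: auto_def)
  show "\<phi> (q \<otimes>\<^bsub>Q\<^esub> r) x = \<phi> q (\<phi> r x)" if "q \<in> carrier Q" "r \<in> carrier Q" "x \<in> carrier N" for q r x
    using hom_mult[OF \<phi> that(1,2)] Bij that by (simp add: AutoGroup_def BijGroup_def compose_eq)
  show "\<phi> \<one>\<^bsub>Q\<^esub> x = x" if "x \<in> carrier N" for x
    using hom_one[OF \<phi> assms(2) group.AutoGroup[OF assms(1)]] that
    by (simp add: AutoGroup_def BijGroup_def)
qed

lemma group_semidirect_product:
  assumes N: "group N" and Q: "group Q" and \<phi>: "\<phi> \<in> hom Q (AutoGroup N)"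
  shows "group (semidirect_product N Q \<phi>)"
proof -
  interpret N: group N by fact
  interpret Q: group Q by fact
  note action = AutoGroup_action[OF N Q \<phi>]
  have closed [simp]: "\<phi> q x \<in> carrier N" if "q \<in> carrier Q" "x \<in> carrier N" for q x
    using hom_in_carrier[OF action(1)] that .
  have mult: "\<phi> q (x \<otimes>\<^bsub>N\<^esub> y) = \<phi> q x \<otimes>\<^bsub>N\<^esub> \<phi> q y"
    if "q \<in> carrier Q" "x \<in> carrier N" "y \<in> carrier N" for q x y
    using hom_mult[OF action(1)] that .
  show ?thesis
  proof (rule groupI)
    fix x assume "x \<in> carrier (semidirect_product N Q \<phi>)"
    then obtain a q where x: "x = (a, q)" "a \<in> carrier N" "q \<in> carrier Q" by auto
    then show "\<exists>y\<in>carrier (semidirect_product N Q \<phi>). y \<otimes>\<^bsub>semidirect_product N Q \<phi>\<^esub> x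
        = \<one>\<^bsub>semidirect_product N Q \<phi>\<^esub>"
      by (intro bexI[of _ "(inv\<^bsub>N\<^esub> \<phi> (inv\<^bsub>Q\<^esub> q) a, inv\<^bsub>Q\<^esub> q)"]) auto
  qed (auto simp: N.m_assoc Q.m_assoc mult action(2,3))
qed

text \<open>The image of \<open>h\<close> is itself an extension of an infinite subgroup of
  \<open>A\<close> by an infinite cyclic group. A formulation by images also covers very large
  groups, where only two elements of the image in the wreath product are prescribed.\<close>

lemma metabelian_top_semidirect_image:
  fixes A :: "('c, 'd) monoid_scheme"
  assumes G: "group G" and A: "comm_group A" "locally_finite A"
    and \<phi>: "\<phi> \<in> hom integer_group (AutoGroup A)"
    and h: "h \<in> hom G (semidirect_product A integer_group \<phi>)"
    and inf: "infinite {a. (a, 0) \<in> h ` carrier G}"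
    and t: "t \<in> h ` carrier G" "snd t = 1"
  shows "\<not> finitely_presented (metabelian_top G)"
proof
  assume fp: "finitely_presented (metabelian_top G)"
  let ?W = "semidirect_product A integer_group \<phi>"
  let ?Q = "?W\<lparr>carrier := h ` carrier G\<rparr>"
  interpret A: comm_group A by fact
  have W: "group ?W"
    using group_semidirect_product[OF A.is_group group_integer_group \<phi>] .
  interpret W: group ?W by (rule W)
  interpret h: group_hom G ?W h using G W h by (simp add: group_hom_def group_hom_axioms_def)
  have im: "subgroup (h ` carrier G) ?W" by (rule h.img_is_subgroup)
  interpret Q: group ?Q by (rule W.subgroup_imp_group[OF im])
  have sub: "h ` carrier G \<subseteq> carrier A \<times> UNIV" using subgroup.subset[OF im] by simp
  interpret E: infinite_cyclic_extension ?Q snd t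
    by unfold_locales (use t in \<open>auto intro!: homI simp: semidirect_product_def\<close>)
  have base: "(a, q) \<in> E.base_group \<longleftrightarrow> (a, q) \<in> h ` carrier G \<and> q = 0" for a q
    by (simp add: E.base_group_iff)
  have base_cases: "\<exists>a\<in>carrier A. x = (a, 0) \<and> x \<in> h ` carrier G" if "x \<in> E.base_group" for x
    using that sub by (cases x) (auto simp: base)
  have \<phi>0: "\<phi> 0 a = a" if "a \<in> carrier A" for a
    using AutoGroup_action(3)[OF A.is_group group_integer_group \<phi> that] by simp
  have comm: "x \<otimes>\<^bsub>?Q\<^esub> y = y \<otimes>\<^bsub>?Q\<^esub> x" if "x \<in> E.base_group" "y \<in> E.base_group" for x y
    using base_cases[OF that(1)] base_cases[OF that(2)] by (auto simp: \<phi>0 A.m_comm)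
  have "infinite E.base_group"
  proof
    assume "finite E.base_group"
    then have "finite (fst ` E.base_group)" by simp
    moreover have "{a. (a, 0) \<in> h ` carrier G} \<subseteq> fst ` E.base_group"
      using base by (metis (no_types, lifting) fst_conv image_eqI mem_Collect_eq subsetI)
    ultimately show False using inf finite_subset by blast
  qed
  moreover have "finite (generate ?Q S)" if S: "S \<subseteq> E.base_group" "finite S" for S
  proof -
    have "fst ` S \<subseteq> carrier A" using S base_cases by fastforce
    then have fin: "finite (generate A (fst ` S))" and sg: "subgroup (generate A (fst ` S)) A"
      using A(2) S(2) A.generate_is_subgroup by (auto simp: locally_finite_def)
    interpret B: subgroup "generate A (fst ` S)" A by (rule sg)
    \<comment> \<open>Local finiteness of \<open>A\<close> is transferred along \<open>fst\<close>.
      This projection is multiplicative on base elements, since \<open>\<phi> 0\<close> acts as the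
      identity.\<close>
    let ?B = "{x \<in> E.base_group. fst x \<in> generate A (fst ` S)}"
    have fst_mult: "fst (x \<otimes>\<^bsub>?Q\<^esub> y) = fst x \<otimes>\<^bsub>A\<^esub> fst y" if "x \<in> E.base_group" "y \<in> E.base_group" for x y
      using base_cases[OF that(1)] base_cases[OF that(2)] by (auto simp: \<phi>0)
    interpret base: subgroup E.base_group ?Q
      by (rule normal_imp_subgroup[OF E.base_group_normal])
    have "subgroup ?B ?Q"
    proof (rule Q.subgroupI)
      show "?B \<subseteq> carrier ?Q" using E.base_group_subset by blast
      have one: "\<one>\<^bsub>?Q\<^esub> \<in> ?B" using base.one_closed by simp
      then show "?B \<noteq> {}" by blast
      fix x assume x: "x \<in> ?B"
      have inv: "inv\<^bsub>?Q\<^esub> x \<in> E.base_group" using x by blast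
      have "fst (inv\<^bsub>?Q\<^esub> x) \<otimes>\<^bsub>A\<^esub> fst x = \<one>\<^bsub>A\<^esub>"
        using fst_mult[OF inv, of x] x Q.l_inv[of x] E.base_group_subset by auto
      moreover have "fst (inv\<^bsub>?Q\<^esub> x) \<in> carrier A" using base_cases[OF inv] fst_conv by metis
      ultimately have "fst (inv\<^bsub>?Q\<^esub> x) = inv\<^bsub>A\<^esub> fst x"
        using x B.mem_carrier by (intro A.inv_equality[symmetric]) auto
      then show "inv\<^bsub>?Q\<^esub> x \<in> ?B" using inv x by auto
      show "x \<otimes>\<^bsub>?Q\<^esub> y \<in> ?B" if "y \<in> ?B" for y
        using x that fst_mult[of x y] base.m_closed[of x y] by auto
    qed
    moreover have "S \<subseteq> ?B" using S by (auto intro: generate.incl)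
    ultimately have "generate ?Q S \<subseteq> ?B" by (intro Q.generate_subgroup_incl)
    moreover have "?B \<subseteq> (\<lambda>a. (a, 0)) ` generate A (fst ` S)"
      using base_cases by fastforce
    ultimately have "generate ?Q S \<subseteq> (\<lambda>a. (a, 0)) ` generate A (fst ` S)"
      by (rule subset_trans)
    then show ?thesis using finite_imageI[OF fin] by (rule finite_subset)
  qed
  ultimately have "\<not> finitely_presented ?Q"
    using comm by (intro E.not_finitely_presented)
  moreover have "metabelian ?Q"
    using comm by (rule E.metabelian_if_base_comm)
  moreover have "maps_onto G ?Q"
  proof -
    have "h \<in> epi G ?Q" using h by (auto simp: epi_def hom_def)
    then show ?thesis by (auto simp: maps_onto_def)
  qed
  ultimately show False
    using metabelian_top_finitely_presented_quotient[OF G fp Q.is_group] by blast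
qed

section \<open>Wreath products with the integers\<close>

lemma carrier_wreath_base:
  "group A \<Longrightarrow> carrier (wreath_base A integer_group) =
    {f. (\<forall>x. f x \<in> carrier A) \<and> finite {x. f x \<noteq> \<one>\<^bsub>A\<^esub>}}"
  by (auto simp: wreath_base_def carrier_sum_group)

lemma wreath_base_simps [simp]:
  "f \<otimes>\<^bsub>wreath_base A integer_group\<^esub> g = (\<lambda>x. f x \<otimes>\<^bsub>A\<^esub> g x)"
  "\<one>\<^bsub>wreath_base A integer_group\<^esub> = (\<lambda>x. \<one>\<^bsub>A\<^esub>)"
  by (simp_all add: wreath_base_def restrict_def)

lemma wreath_action_eq:
  "f \<in> carrier (wreath_base A integer_group) \<Longrightarrow>
    wreath_action A integer_group q f = (\<lambda>x. f (x - q))"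
  by (simp add: wreath_action_def restrict_def)

lemma comm_group_wreath_base:
  assumes "comm_group A"
  shows "comm_group (wreath_base A integer_group)"
proof -
  interpret comm_group A by fact
  have "group (wreath_base A integer_group)" by (simp add: wreath_base_def)
  then show ?thesis
    by (rule group.group_comm_groupI) (auto simp: carrier_wreath_base m_comm)
qed

text \<open>Finitely many families have a finite common support \<open>U\<close>, and only finitely
  many families supported in \<open>U\<close> take values in the finite group
  \<open>A\<close>.\<close>

lemma locally_finite_wreath_base:
  assumes A: "group A" "finite (carrier A)"
  shows "locally_finite (wreath_base A integer_group)"
  unfolding locally_finite_def
proof (intro allI impI)
  fix S :: "(int \<Rightarrow> 'a) set"
  let ?B = "wreath_base A integer_group"
  interpret A: group A by fact
  interpret B: group ?B by (simp add: wreath_base_def A)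
  assume S: "S \<subseteq> carrier ?B" "finite S"
  define U where "U = (\<Union>f\<in>S. {x. f x \<noteq> \<one>\<^bsub>A\<^esub>})"
  have U: "finite U" using S A by (auto simp: U_def carrier_wreath_base)
  let ?H = "{f \<in> carrier ?B. \<forall>x. x \<notin> U \<longrightarrow> f x = \<one>\<^bsub>A\<^esub>}"
  have inv: "(inv\<^bsub>?B\<^esub> f) x = inv\<^bsub>A\<^esub> f x" if "f \<in> carrier ?B" for f x
    using that by (simp add: wreath_base_def)
  have "subgroup ?H ?B"
  proof (rule B.subgroupI)
    have "\<one>\<^bsub>?B\<^esub> \<in> ?H" using B.one_closed by simp
    then show "?H \<noteq> {}" by blast
    show "inv\<^bsub>?B\<^esub> f \<in> ?H" if "f \<in> ?H" for f
      using that by (simp add: inv)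
    show "f \<otimes>\<^bsub>?B\<^esub> g \<in> ?H" if "f \<in> ?H" "g \<in> ?H" for f g
      using that B.m_closed[of f g] by simp
  qed auto
  moreover have "S \<subseteq> ?H" using S by (auto simp: U_def)
  ultimately have "generate ?B S \<subseteq> ?H" by (intro B.generate_subgroup_incl)
  also have "?H \<subseteq> {f. \<forall>x. (x \<in> U \<longrightarrow> f x \<in> carrier A) \<and> (x \<notin> U \<longrightarrow> f x = \<one>\<^bsub>A\<^esub>)}"
    using A by (auto simp: carrier_wreath_base)
  finally show "finite (generate ?B S)"
    using finite_set_of_finite_funs[OF U A(2)] finite_subset by blast
qed

lemma wreath_action_hom:
  assumes A: "group A"
  shows "wreath_action A integer_group \<in> hom integer_group (AutoGroup (wreath_base A integer_group))"
proof -
  let ?B = "wreath_base A integer_group" and ?\<alpha> = "wreath_action A integer_group"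
  interpret A: group A by fact
  have B: "group ?B" by (simp add: wreath_base_def A)
  interpret B: group ?B by (rule B)
  have closed: "?\<alpha> q f \<in> carrier ?B" if f: "f \<in> carrier ?B" for q f
  proof -
    have "{x. f (x - q) \<noteq> \<one>\<^bsub>A\<^esub>} = (\<lambda>x. x + q) ` {x. f x \<noteq> \<one>\<^bsub>A\<^esub>}"
      by (auto simp: image_iff intro!: exI[of _ "_ - q"])
    then show ?thesis using f A by (simp add: wreath_action_eq carrier_wreath_base)
  qed
  have comp: "?\<alpha> q (?\<alpha> r f) = ?\<alpha> (q + r) f" if "f \<in> carrier ?B" for q r f
    using that closed[OF that] by (simp add: wreath_action_eq algebra_simps)
  have zero: "?\<alpha> 0 f = f" if "f \<in> carrier ?B" for f
    using that by (simp add: wreath_action_eq)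
  have hom: "?\<alpha> q \<in> hom ?B ?B" for q
  proof (rule homI)
    show "?\<alpha> q (f \<otimes>\<^bsub>?B\<^esub> g) = ?\<alpha> q f \<otimes>\<^bsub>?B\<^esub> ?\<alpha> q g" if "f \<in> carrier ?B" "g \<in> carrier ?B" for f g
      using that B.m_closed[OF that] by (simp add: wreath_action_eq)
  qed (rule closed)
  have bij: "bij_betw (?\<alpha> q) (carrier ?B) (carrier ?B)" for q
    by (rule bij_betw_byWitness[of _ "?\<alpha> (- q)"]) (auto simp: comp zero closed)
  have Bij: "?\<alpha> q \<in> Bij (carrier ?B)" for q
    using bij by (simp add: Bij_def wreath_action_def)
  \<comment> \<open>The homomorphism law is an equation between functions on the whole type, so the
    default values outside the base group have to agree too.\<close>
  have undef: "?\<alpha> q f = undefined" if "f \<notin> carrier ?B" for q f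
    using that by (simp add: wreath_action_def)
  show ?thesis
  proof (rule homI)
    show "?\<alpha> q \<in> carrier (AutoGroup ?B)" for q
      using hom Bij by (simp add: AutoGroup_def auto_def)
    have "?\<alpha> (q + r) = compose (carrier ?B) (?\<alpha> q) (?\<alpha> r)" for q r
      by (rule ext) (auto simp: compose_def comp undef)
    then show "?\<alpha> (q \<otimes>\<^bsub>integer_group\<^esub> r) = ?\<alpha> q \<otimes>\<^bsub>AutoGroup ?B\<^esub> ?\<alpha> r" for q r
      using Bij by (simp add: AutoGroup_def BijGroup_def)
  qed
qed

lemma group_wreath_product:
  "group A \<Longrightarrow> group (wreath_product A integer_group)"
  unfolding wreath_product_def
  by (intro group_semidirect_product wreath_action_hom) (simp_all add: wreath_base_def)

text \<open>A generator of the summand at position k. Residues are represented by integers, so the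
  same function serves integral and modular coefficients; modulus 1 is exceptional because 1 is then
  not a residue.\<close>

definition unit_family :: "int \<Rightarrow> int \<Rightarrow> int" where
  "unit_family k = (\<lambda>x. if x = k then 1 else 0)"

lemma unit_family_mem: "m \<noteq> 1 \<Longrightarrow> unit_family k \<in> carrier (wreath_base (integer_mod_group m) integer_group)"
  by (auto simp: carrier_wreath_base unit_family_def)

text \<open>Conjugation by the generator of the top group shifts the unit family by one position, so
  a single unit family in the image produces infinitely many base elements.\<close>

lemma metabelian_top_wreath_image:
  assumes G: "group G" and m: "m > 1"
    and h: "h \<in> hom G (wreath_product (integer_mod_group m) integer_group)"
    and unit: "(unit_family 0, 0) \<in> h ` carrier G" and t: "(\<lambda>_. 0, 1) \<in> h ` carrier G"
  shows "\<not> finitely_presented (metabelian_top G)"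
proof -
  let ?A = "integer_mod_group m"
  let ?W = "wreath_product ?A integer_group"
  have W: "group ?W" by (simp add: group_wreath_product)
  interpret W: group ?W by (rule W)
  interpret h: group_hom G ?W h using G W h by (simp add: group_hom_def group_hom_axioms_def)
  interpret H: subgroup "h ` carrier G" ?W by (rule h.img_is_subgroup)
  have "(unit_family (int k), 0) \<in> h ` carrier G" for k
  proof (induction k)
    case (Suc k)
    let ?t = "(\<lambda>_::int. 0::int, 1::int)"
    let ?x = "(unit_family (int k), 0::int)" and ?y = "(unit_family (int (Suc k)), 0::int)"
    have fam: "unit_family j \<in> carrier (wreath_base ?A integer_group)" for j
      using m by (simp add: unit_family_mem)
    have tc: "?t \<in> carrier ?W" using t H.mem_carrier by blast
    have zero: "(\<lambda>_. 0) \<in> carrier (wreath_base ?A integer_group)"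
      by (simp add: carrier_wreath_base)
    have "?t \<otimes>\<^bsub>?W\<^esub> ?x = ?y \<otimes>\<^bsub>?W\<^esub> ?t"
      using fam[of "int k"] zero m
      by (auto simp: wreath_product_def wreath_action_eq unit_family_def fun_eq_iff)
    moreover have "?x \<in> carrier ?W" "?y \<in> carrier ?W"
      using fam by (simp_all add: wreath_product_def)
    ultimately have "?y = ?t \<otimes>\<^bsub>?W\<^esub> ?x \<otimes>\<^bsub>?W\<^esub> inv\<^bsub>?W\<^esub> ?t"
      using tc by (intro W.inv_solve_right[THEN iffD2]) auto
    then show ?case using Suc t by simp
  qed (use unit in simp)
  then have "range (\<lambda>k. unit_family (int k)) \<subseteq> {f. (f, 0) \<in> h ` carrier G}"
    by auto
  moreover have "inj (\<lambda>k. unit_family (int k))"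
  proof (rule injI)
    fix k l assume "unit_family (int k) = unit_family (int l)"
    then have "unit_family (int k) (int k) = unit_family (int l) (int k)" by simp
    then show "k = l" by (simp add: unit_family_def split: if_splits)
  qed
  ultimately have "infinite {f. (f, 0) \<in> h ` carrier G}"
    using range_inj_infinite finite_subset by blast
  moreover have "finite (carrier ?A)" using m by (simp add: carrier_integer_mod_group)
  ultimately show ?thesis
    using h t unfolding wreath_product_def
    by (intro metabelian_top_semidirect_image[OF G comm_group_wreath_base
        locally_finite_wreath_base wreath_action_hom, where t = "(\<lambda>_. 0, 1)"]) auto
qed

text \<open>Reduction of the coefficients brings the wreath product of two infinite cyclic groups
  under the case of a finite coefficient group.\<close>

lemma wreath_mod_hom:
  assumes "m > 0"
  shows "(\<lambda>(f, k). (\<lambda>x. f x mod int m, k)) \<in>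
    hom (wreath_product integer_group integer_group) (wreath_product (integer_mod_group m) integer_group)"
proof (rule homI)
  have mem: "(\<lambda>x. f x mod int m) \<in> carrier (wreath_base (integer_mod_group m) integer_group)"
    if "f \<in> carrier (wreath_base integer_group integer_group)" for f
  proof -
    have "finite {x. f x \<noteq> 0}" using that by (simp add: carrier_wreath_base)
    then have "finite {x. f x mod int m \<noteq> 0}" by (rule rev_finite_subset) auto
    then show ?thesis using assms by (simp add: carrier_wreath_base carrier_integer_mod_group)
  qed
  show "(case x of (f, k) \<Rightarrow> (\<lambda>x. f x mod int m, k)) \<in>
      carrier (wreath_product (integer_mod_group m) integer_group)"
    if "x \<in> carrier (wreath_product integer_group integer_group)" for x
    using that mem by (auto simp: wreath_product_def)
  fix x y assume "x \<in> carrier (wreath_product integer_group integer_group)"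
    "y \<in> carrier (wreath_product integer_group integer_group)"
  then show "(case x \<otimes>\<^bsub>wreath_product integer_group integer_group\<^esub> y of
      (f, k) \<Rightarrow> (\<lambda>x. f x mod int m, k)) =
    (case x of (f, k) \<Rightarrow> (\<lambda>x. f x mod int m, k))
      \<otimes>\<^bsub>wreath_product (integer_mod_group m) integer_group\<^esub>
    (case y of (f, k) \<Rightarrow> (\<lambda>x. f x mod int m, k))"
    using mem by (auto simp: wreath_product_def wreath_action_eq mod_add_eq)
qed

section \<open>Very large groups\<close>

text \<open>With at most one basis element all generators commute, and then so do all
  elements.\<close>

lemma free_group_noncommutative_basis:
  assumes "\<not> comm_group (free_group S)"
  obtains x y where "x \<in> S" "y \<in> S" "x \<noteq> y"
proof -
  interpret group "free_group S" by simp
  have "\<not> (\<forall>x\<in>S. \<forall>y\<in>S. x = y)"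
  proof
    assume eq: "\<forall>x\<in>S. \<forall>y\<in>S. x = y"
    have gens: "free_gen S ` S \<subseteq> carrier (free_group S)" by auto
    have "a \<otimes>\<^bsub>free_group S\<^esub> b = b \<otimes>\<^bsub>free_group S\<^esub> a"
      if "a \<in> free_gen S ` S" "b \<in> free_gen S ` S" for a b
      using that eq by auto
    then have "comm_group (free_group S)"
      using generate_commute[OF gens] unfolding generate_free_group
      by (intro group_comm_groupI) blast
    then show False using assms by blast
  qed
  then show ?thesis using that by blast
qed

lemma very_large_wreath_image:
  assumes "group G" "very_large TYPE('f) G"
  obtains h where "h \<in> hom G (wreath_product (integer_mod_group 2) integer_group)"
    "(unit_family 0, 0) \<in> h ` carrier G" "(\<lambda>_. 0, 1) \<in> h ` carrier G"
proof -
  let ?W = "wreath_product (integer_mod_group 2) integer_group"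
  obtain F :: "'f monoid" where F: "is_free_group F" "\<not> comm_group F" "maps_onto G F"
    using assms by (auto simp: very_large_def)
  obtain p where p: "p \<in> epi G F" using F by (auto simp: maps_onto_def)
  obtain S :: "'f set" where grp: "group F" and S: "F \<cong> free_group S"
    using F by (auto simp: is_free_group_def)
  obtain i where i: "i \<in> iso F (free_group S)" using S by (auto simp: is_iso_def)
  have nc: "\<not> comm_group (free_group S)"
    using comm_group.iso_imp_comm_group[OF _ group.iso_sym[OF grp S]] F(2) group.is_monoid[OF grp]
    by blast
  obtain x y where xy: "x \<in> S" "y \<in> S" "x \<noteq> y"
    using free_group_noncommutative_basis[OF nc] .
  interpret W: group ?W by (simp add: group_wreath_product)
  have memW: "(unit_family 0, 0) \<in> carrier ?W" "(\<lambda>_. 0, 1) \<in> carrier ?W"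
    using unit_family_mem[of 2 0] by (simp_all add: wreath_product_def carrier_wreath_base)
  \<comment> \<open>One basis element goes to the unit family and all others, in particular
    \<open>y\<close>, to the generator of the top group. This works for a basis of any cardinality.
    The modulus 2 is just the smallest one greater than 1.\<close>
  define f where "f z = (if z = x then (unit_family 0, 0) else (\<lambda>_. 0, 1::int))" for z
  have "f \<in> S \<rightarrow> carrier ?W" using memW by (simp add: f_def)
  then obtain k where k: "k \<in> hom (free_group S) ?W" "\<And>z. z \<in> S \<Longrightarrow> k (free_gen S z) = f z"
    by (rule W.free_group_lift) blast
  have ip: "i \<circ> p \<in> epi G (free_group S)"
    using p i by (auto simp: iso_iff_mon_epi intro: epi_compose)
  then have surj: "(i \<circ> p) ` carrier G = carrier (free_group S)" by (simp add: epi_def)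
  have img: "f z \<in> (k \<circ> (i \<circ> p)) ` carrier G" if "z \<in> S" for z
  proof -
    have "free_gen S z \<in> (i \<circ> p) ` carrier G" unfolding surj using that by simp
    then have "k (free_gen S z) \<in> k ` (i \<circ> p) ` carrier G" by (rule imageI)
    then show ?thesis using k(2)[OF that] by (simp add: image_comp)
  qed
  show thesis
  proof (rule that)
    show "k \<circ> (i \<circ> p) \<in> hom G ?W"
      using ip k(1) by (auto simp: epi_def intro: Group.hom_compose)
  qed (use img[OF xy(1)] img[OF xy(2)] xy(3) in \<open>simp_all add: f_def\<close>)
qed

theorem theorem3p5:
  fixes \<Gamma> :: "('a, 'b) monoid_scheme"
  assumes "group \<Gamma>"
    and "finitely_generated \<Gamma>"
    and "very_large TYPE('f) \<Gamma>
       \<or> maps_onto \<Gamma> (wreath_product integer_group integer_group)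
       \<or> (\<exists>m>1. maps_onto \<Gamma> (wreath_product (integer_mod_group m) integer_group))
       \<or> (\<exists>(A::'c monoid) \<phi>. comm_group A \<and> infinite (carrier A) \<and> locally_finite A
            \<and> \<phi> \<in> hom integer_group (AutoGroup A)
            \<and> maps_onto \<Gamma> (semidirect_product A integer_group \<phi>))
       \<or> (\<exists>M::'d monoid. group M \<and> metabelian M \<and> infinitely_related M \<and> maps_onto \<Gamma> M)"
  shows "\<not> finitely_presented (metabelian_top \<Gamma>)"
  using assms(3)
proof (elim disjE exE conjE)
  assume "very_large TYPE('f) \<Gamma>"
  then obtain h where "h \<in> hom \<Gamma> (wreath_product (integer_mod_group 2) integer_group)"
    "(unit_family 0, 0) \<in> h ` carrier \<Gamma>" "(\<lambda>_. 0, 1) \<in> h ` carrier \<Gamma>"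
    using very_large_wreath_image[OF assms(1)] by blast
  then show ?thesis using metabelian_top_wreath_image[OF assms(1), of 2] by simp
next
  let ?Z = "wreath_product integer_group integer_group"
  \<comment> \<open>Coefficients are reduced modulo 2, which keeps the unit family and the generator
    of the top group unchanged.\<close>
  let ?r = "\<lambda>(f, k). (\<lambda>x::int. f x mod int 2, k::int)"
  assume "maps_onto \<Gamma> ?Z"
  then obtain h where h: "h \<in> hom \<Gamma> ?Z" "h ` carrier \<Gamma> = carrier ?Z"
    by (auto simp: maps_onto_def epi_def)
  have Z: "(unit_family 0, 0) \<in> carrier ?Z" "(\<lambda>_. 0, 1) \<in> carrier ?Z"
    by (simp_all add: wreath_product_def carrier_wreath_base unit_family_def)
  have "?r (unit_family 0, 0) \<in> ?r ` h ` carrier \<Gamma>" "?r (\<lambda>_. 0, 1) \<in> ?r ` h ` carrier \<Gamma>"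
    unfolding h(2) by (rule imageI, rule Z)+
  moreover have "?r (unit_family 0, 0) = (unit_family 0, 0)"
    by (auto simp: unit_family_def)
  ultimately have "(unit_family 0, 0) \<in> (?r \<circ> h) ` carrier \<Gamma>" "(\<lambda>_. 0, 1) \<in> (?r \<circ> h) ` carrier \<Gamma>"
    by (simp_all add: image_comp)
  moreover have "?r \<circ> h \<in> hom \<Gamma> (wreath_product (integer_mod_group 2) integer_group)"
    using Group.hom_compose[OF h(1) wreath_mod_hom[of 2]] by simp
  ultimately show ?thesis using metabelian_top_wreath_image[OF assms(1), of 2] by simp
next
  fix m :: nat assume m: "1 < m" "maps_onto \<Gamma> (wreath_product (integer_mod_group m) integer_group)"
  then obtain h where h: "h \<in> hom \<Gamma> (wreath_product (integer_mod_group m) integer_group)"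
    "h ` carrier \<Gamma> = carrier (wreath_product (integer_mod_group m) integer_group)"
    by (auto simp: maps_onto_def epi_def)
  show ?thesis
    by (rule metabelian_top_wreath_image[OF assms(1) m(1) h(1)])
      (use m(1) unit_family_mem[of m] in \<open>simp_all add: h(2) wreath_product_def carrier_wreath_base\<close>)
next
  fix A :: "'c monoid" and \<phi>
  assume A: "comm_group A" "infinite (carrier A)" "locally_finite A"
    "\<phi> \<in> hom integer_group (AutoGroup A)" "maps_onto \<Gamma> (semidirect_product A integer_group \<phi>)"
  then obtain h where h: "h \<in> hom \<Gamma> (semidirect_product A integer_group \<phi>)"
    "h ` carrier \<Gamma> = carrier (semidirect_product A integer_group \<phi>)"
    by (auto simp: maps_onto_def epi_def)
  interpret A: comm_group A by fact
  show ?thesis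
    by (rule metabelian_top_semidirect_image[OF assms(1) A(1,3,4) h(1), of "(\<one>\<^bsub>A\<^esub>, 1)"])
      (use A(2) in \<open>simp_all add: h(2)\<close>)
next
  fix M :: "'d monoid"
  assume "group M" "metabelian M" "infinitely_related M" "maps_onto \<Gamma> M"
  then show ?thesis
    using metabelian_top_finitely_presented_quotient[OF assms(1)] by (auto simp: infinitely_related_def)
qed

end
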